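(* Let $d\ge1$ and let $\kappa$ and $\lambda$ be regular uncountable cardinals. For every $q<\omega$ and every $d$-colored ordinal $\mathfrak A=(\lambda,<,C_0,\dots,C_{d-1})$ there is a $d$-colored ordinal $\mathfrak B=(\kappa,<,D_0,\dots,D_{d-1})$ such that $\mathfrak A\equiv_q\mathfrak B$.
   Context: A $d$-colored ordinal is a structure $(A,<,C_0,\dots,C_{d-1})$ where $(A,<)$ is an ordinal and the unary predicates $C_i$ partition $A$. $\mathfrak A\equiv_q\mathfrak B$ means agreement on all first-order sentences of quantifier rank at most $q$ in the language with the order and $d$ unary color predicates. *)

theory Defs
  imports "HOL-Library.Disjoint_Sets"
begin

unbundle cardinal_syntax

(* Well-orders follow the reflexive convention of the library: an ordinal is given by a
   well-order r, its universe is Field r, and its strict order is r minus the diagonal.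
   Colour classes may be empty. *)

definition colored_ordinal :: "nat \<Rightarrow> 'a rel \<Rightarrow> (nat \<Rightarrow> 'a set) \<Rightarrow> bool" where
  "colored_ordinal d r C \<longleftrightarrow>
     Well_order r \<and> (\<Union>i<d. C i) = Field r \<and> disjoint_family_on C {..<d}"

(* First-order formulas with variables named by natural numbers; Falsum makes rank-0
   sentences exist, the language being purely relational. *)
datatype fm =
    Falsum
  | Eq nat nat
  | Less nat nat
  | Col nat nat  \<comment> \<open>\<open>Col i x\<close>: the element \<open>x\<close> has colour \<open>i\<close>\<close>
  | Neg fm
  | Conj fm fm
  | Ex nat fm

primrec colors :: "fm \<Rightarrow> nat set" where
  "colors Falsum = {}"
| "colors (Eq x y) = {}"
| "colors (Less x y) = {}"
| "colors (Col i x) = {i}"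
| "colors (Neg \<phi>) = colors \<phi>"
| "colors (Conj \<phi> \<psi>) = colors \<phi> \<union> colors \<psi>"
| "colors (Ex x \<phi>) = colors \<phi>"

primrec fv :: "fm \<Rightarrow> nat set" where
  "fv Falsum = {}"
| "fv (Eq x y) = {x, y}"
| "fv (Less x y) = {x, y}"
| "fv (Col i x) = {x}"
| "fv (Neg \<phi>) = fv \<phi>"
| "fv (Conj \<phi> \<psi>) = fv \<phi> \<union> fv \<psi>"
| "fv (Ex x \<phi>) = fv \<phi> - {x}"

primrec qr :: "fm \<Rightarrow> nat" where
  "qr Falsum = 0"
| "qr (Eq x y) = 0"
| "qr (Less x y) = 0"
| "qr (Col i x) = 0"
| "qr (Neg \<phi>) = qr \<phi>"
| "qr (Conj \<phi> \<psi>) = max (qr \<phi>) (qr \<psi>)"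
| "qr (Ex x \<phi>) = Suc (qr \<phi>)"

primrec sat :: "'a rel \<Rightarrow> (nat \<Rightarrow> 'a set) \<Rightarrow> (nat \<Rightarrow> 'a) \<Rightarrow> fm \<Rightarrow> bool" where
  "sat r C e Falsum \<longleftrightarrow> False"
| "sat r C e (Eq x y) \<longleftrightarrow> e x = e y"
| "sat r C e (Less x y) \<longleftrightarrow> (e x, e y) \<in> r \<and> e x \<noteq> e y"
| "sat r C e (Col i x) \<longleftrightarrow> e x \<in> C i"
| "sat r C e (Neg \<phi>) \<longleftrightarrow> \<not> sat r C e \<phi>"
| "sat r C e (Conj \<phi> \<psi>) \<longleftrightarrow> sat r C e \<phi> \<and> sat r C e \<psi>"
| "sat r C e (Ex x \<phi>) \<longleftrightarrow> (\<exists>a\<in>Field r. sat r C (e(x := a)) \<phi>)"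

definition sentence :: "nat \<Rightarrow> fm \<Rightarrow> bool" where
  "sentence d \<phi> \<longleftrightarrow> fv \<phi> = {} \<and> colors \<phi> \<subseteq> {..<d}"

definition models :: "'a rel \<Rightarrow> (nat \<Rightarrow> 'a set) \<Rightarrow> fm \<Rightarrow> bool" where
  "models r C \<phi> \<longleftrightarrow> (\<forall>e. sat r C e \<phi>)"

lemma sat_cong_fv:
  "(\<And>x. x \<in> fv \<phi> \<Longrightarrow> e x = e' x) \<Longrightarrow> sat r C e \<phi> \<longleftrightarrow> sat r C e' \<phi>"
proof (induction \<phi> arbitrary: e e')
  case (Conj \<phi> \<psi>)
  then show ?case by (metis UnCI fv.simps(6) sat.simps(6))
next
  case (Neg \<phi>)
  then show ?case by (metis fv.simps(5) sat.simps(5))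
next
  case (Ex x \<phi>)
  have "sat r C (e(x := a)) \<phi> \<longleftrightarrow> sat r C (e'(x := a)) \<phi>" for a
    by (rule Ex.IH) (use Ex.prems in auto)
  then show ?case by simp
qed auto

(* Hence the quantification over all assignments in models is harmless for sentences. *)
lemma models_iff_sat:
  assumes "sentence d \<phi>"
  shows "models r C \<phi> \<longleftrightarrow> sat r C e \<phi>"
  using assms sat_cong_fv[of \<phi>] unfolding models_def sentence_def by blast

definition fo_equiv ::
  "nat \<Rightarrow> nat \<Rightarrow> 'a rel \<Rightarrow> (nat \<Rightarrow> 'a set) \<Rightarrow> 'b rel \<Rightarrow> (nat \<Rightarrow> 'b set) \<Rightarrow> bool" where
  "fo_equiv d q r C s D \<longleftrightarrow>
     (\<forall>\<phi>. sentence d \<phi> \<and> qr \<phi> \<le> q \<longrightarrow> (models r C \<phi> \<longleftrightarrow> models s D \<phi>))"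

end

theory Submission
  imports Defs "HOL-Library.Countable_Set_Type"
begin

text \<open>Write \<open>\<equiv>\<close> for equivalence up to quantifier rank \<open>q\<close>. By regularity and uncountability, arbitrarily
  large initial segments of \<open>\<AA>\<close> are closed under Skolem functions, and a limit of an \<open>\<omega>\<close>-sequence of
  such segments is again closed. For a closed segment \<open>[0, \<delta>)\<close> and \<open>s < \<delta>\<close> we have \<open>[s, \<delta>) \<equiv> [s, \<mu>)\<close>.
  As there are only finitely many types, there are closed \<open>s\<^sub>0 < s\<^sub>1 < \<dots>\<close>
  for which all tails \<open>[s\<^sub>i, \<mu>)\<close> have the same type; with \<open>\<delta> = sup s\<^sub>i\<close>, the tail \<open>T = [s\<^sub>0, \<mu>) \<equiv> [s\<^sub>0, \<delta>)\<close>
  is then equivalent to an \<open>\<omega>\<close>-sum of pieces \<open>[s\<^sub>i, s\<^sub>i\<^sub>+\<^sub>1) \<equiv> T\<close>, that is, \<open>T \<cdot> \<omega> \<equiv> T\<close>. By induction \<open>T \<cdot> \<beta> \<equiv> T\<close> for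
  all countable \<open>\<beta> > 0\<close>, and \<open>T \<cdot> \<kappa> \<equiv> T\<close> because the order \<open>\<kappa>\<close> is equivalent to a countable
  ordinal. Replacing \<open>L = [0, s\<^sub>0)\<close> and \<open>T\<close> by countable elementary substructures, \<open>L + T \<cdot> \<kappa>\<close> has order
  type \<open>\<kappa>\<close> and is equivalent to \<open>L + T\<close>.\<close>

subsection \<open>Ehrenfeucht--Fraisse equivalence of linear orders\<close>

text \<open>Only elements of \<open>X\<close> are constrained, so that one predicate
  \<open>lt\<close> on an ambient order serves all of its subsets.\<close>

definition lin_on :: "'a set \<Rightarrow> ('a \<Rightarrow> 'a \<Rightarrow> bool) \<Rightarrow> bool" where
  "lin_on X lt \<longleftrightarrow> (\<forall>x\<in>X. \<not> lt x x) \<and> (\<forall>x\<in>X. \<forall>y\<in>X. \<forall>z\<in>X. lt x y \<longrightarrow> lt y z \<longrightarrow> lt x z) \<and>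
     (\<forall>x\<in>X. \<forall>y\<in>X. x = y \<or> lt x y \<or> lt y x)"

definition before :: "('a \<Rightarrow> 'a \<Rightarrow> bool) \<Rightarrow> 'a set \<Rightarrow> 'a \<Rightarrow> 'a set" where
  "before lt X x = {z \<in> X. lt z x}"

definition after :: "('a \<Rightarrow> 'a \<Rightarrow> bool) \<Rightarrow> 'a set \<Rightarrow> 'a \<Rightarrow> 'a set" where
  "after lt X x = {z \<in> X. lt x z}"

definition precedes :: "('a \<Rightarrow> 'a \<Rightarrow> bool) \<Rightarrow> 'a set \<Rightarrow> 'a set \<Rightarrow> bool" where
  "precedes lt X Y \<longleftrightarrow> (\<forall>x\<in>X. \<forall>y\<in>Y. lt x y)"

lemma lin_on_subset: "lin_on X lt \<Longrightarrow> Y \<subseteq> X \<Longrightarrow> lin_on Y lt"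
  unfolding lin_on_def by blast

lemma lin_on_irrefl: "lin_on X lt \<Longrightarrow> x \<in> X \<Longrightarrow> \<not> lt x x"
  unfolding lin_on_def by blast

lemma lin_on_trans:
  "lin_on X lt \<Longrightarrow> lt x y \<Longrightarrow> lt y z \<Longrightarrow> x \<in> X \<Longrightarrow> y \<in> X \<Longrightarrow> z \<in> X \<Longrightarrow> lt x z"
  unfolding lin_on_def by blast

lemma lin_on_asym: "lin_on X lt \<Longrightarrow> lt x y \<Longrightarrow> x \<in> X \<Longrightarrow> y \<in> X \<Longrightarrow> \<not> lt y x"
  unfolding lin_on_def by blast

lemma lin_on_total: "lin_on X lt \<Longrightarrow> x \<in> X \<Longrightarrow> y \<in> X \<Longrightarrow> x = y \<or> lt x y \<or> lt y x"
  unfolding lin_on_def by blast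

text \<open>For linear orders no parameters are needed: a move at \<open>x\<close> splits the game into independent
  games before and after \<open>x\<close>. Elements are paired by an arbitrary relation \<open>M\<close>, so that in sums the
  summands themselves can serve as colours of the index order.\<close>

primrec ef :: "('a \<Rightarrow> 'a \<Rightarrow> bool) \<Rightarrow> ('b \<Rightarrow> 'b \<Rightarrow> bool) \<Rightarrow> ('a \<Rightarrow> 'b \<Rightarrow> bool) \<Rightarrow> nat \<Rightarrow>
    'a set \<Rightarrow> 'b set \<Rightarrow> bool" where
  "ef lt lt' M 0 X Y \<longleftrightarrow> True"
| "ef lt lt' M (Suc n) X Y \<longleftrightarrow>
    (\<forall>x\<in>X. \<exists>y\<in>Y. M x y \<and> ef lt lt' M n (before lt X x) (before lt' Y y) \<and>
        ef lt lt' M n (after lt X x) (after lt' Y y)) \<and>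
    (\<forall>y\<in>Y. \<exists>x\<in>X. M x y \<and> ef lt lt' M n (before lt X x) (before lt' Y y) \<and>
        ef lt lt' M n (after lt X x) (after lt' Y y))"

lemma before_subset: "before lt X x \<subseteq> X"
  unfolding before_def by blast

lemma after_subset: "after lt X x \<subseteq> X"
  unfolding after_def by blast

lemma ef_SucI:
  assumes "\<And>x. x \<in> X \<Longrightarrow> \<exists>y\<in>Y. M x y \<and> ef lt lt' M n (before lt X x) (before lt' Y y) \<and>
        ef lt lt' M n (after lt X x) (after lt' Y y)"
    and "\<And>y. y \<in> Y \<Longrightarrow> \<exists>x\<in>X. M x y \<and> ef lt lt' M n (before lt X x) (before lt' Y y) \<and>
        ef lt lt' M n (after lt X x) (after lt' Y y)"
  shows "ef lt lt' M (Suc n) X Y"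
  using assms by simp

lemma ef_SucE1:
  assumes "ef lt lt' M (Suc n) X Y" "x \<in> X"
  obtains y where "y \<in> Y" "M x y" "ef lt lt' M n (before lt X x) (before lt' Y y)"
    "ef lt lt' M n (after lt X x) (after lt' Y y)"
  using assms by auto

lemma ef_SucE2:
  assumes "ef lt lt' M (Suc n) X Y" "y \<in> Y"
  obtains x where "x \<in> X" "M x y" "ef lt lt' M n (before lt X x) (before lt' Y y)"
    "ef lt lt' M n (after lt X x) (after lt' Y y)"
  using assms by auto

declare ef.simps(2) [simp del]

text \<open>The common induction step for weakening the pairing relation and for lowering the rank:
  the answer is kept, and both remaining games are converted by \<open>step\<close>.\<close>

lemma ef_Suc_mono:
  assumes ef: "ef lt lt' M (Suc n) X Y"
    and step: "\<And>x y. x \<in> X \<Longrightarrow> y \<in> Y \<Longrightarrow> M x y \<Longrightarrow> N x y"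
      "\<And>U V. U \<subseteq> X \<Longrightarrow> V \<subseteq> Y \<Longrightarrow> ef lt lt' M n U V \<Longrightarrow> ef lt lt' N m U V"
  shows "ef lt lt' N (Suc m) X Y"
proof (rule ef_SucI)
  fix x assume x: "x \<in> X"
  then obtain y where "y \<in> Y" "M x y" "ef lt lt' M n (before lt X x) (before lt' Y y)"
    "ef lt lt' M n (after lt X x) (after lt' Y y)" by (rule ef_SucE1[OF ef])
  then show "\<exists>y\<in>Y. N x y \<and> ef lt lt' N m (before lt X x) (before lt' Y y) \<and>
        ef lt lt' N m (after lt X x) (after lt' Y y)"
    using step(1)[OF x] step(2)[OF before_subset before_subset] step(2)[OF after_subset after_subset]
    by blast
next
  fix y assume y: "y \<in> Y"
  then obtain x where "x \<in> X" "M x y" "ef lt lt' M n (before lt X x) (before lt' Y y)"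
    "ef lt lt' M n (after lt X x) (after lt' Y y)" by (rule ef_SucE2[OF ef])
  then show "\<exists>x\<in>X. N x y \<and> ef lt lt' N m (before lt X x) (before lt' Y y) \<and>
        ef lt lt' N m (after lt X x) (after lt' Y y)"
    using step(1)[OF _ y] step(2)[OF before_subset before_subset] step(2)[OF after_subset after_subset]
    by blast
qed

lemma ef_mono_match:
  assumes "ef lt lt' M n X Y" "\<And>x y. x \<in> X \<Longrightarrow> y \<in> Y \<Longrightarrow> M x y \<Longrightarrow> N x y"
  shows "ef lt lt' N n X Y"
  using assms
proof (induction n arbitrary: X Y)
  case (Suc n)
  show ?case
  proof (rule ef_Suc_mono[OF Suc.prems])
    fix U V assume "U \<subseteq> X" "V \<subseteq> Y" "ef lt lt' M n U V"
    then show "ef lt lt' N n U V" using Suc.prems(2) by (intro Suc.IH) auto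
  qed
qed simp

lemma ef_Suc_imp: "ef lt lt' M (Suc n) X Y \<Longrightarrow> ef lt lt' M n X Y"
proof (induction n arbitrary: X Y)
  case (Suc n)
  show ?case by (rule ef_Suc_mono[OF Suc.prems _ Suc.IH])
qed simp

lemma ef_mono_rank: "ef lt lt' M n X Y \<Longrightarrow> m \<le> n \<Longrightarrow> ef lt lt' M m X Y"
  by (induction n) (auto simp: le_Suc_eq dest: ef_Suc_imp)

lemma ef_sym: "ef lt lt' M n X Y \<Longrightarrow> ef lt' lt (\<lambda>y x. M x y) n Y X"
proof (induction n arbitrary: X Y)
  case (Suc n)
  show ?case
    by (rule ef_SucI) (use Suc.IH in \<open>blast elim: ef_SucE1[OF Suc.prems] ef_SucE2[OF Suc.prems]\<close>)+
qed simp

text \<open>Answers are composed through \<open>Y\<close>, and the pairing relations with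
  them.\<close>

lemma ef_trans:
  assumes "ef lt lt' M n X Y" "ef lt' lt'' N n Y Z" "\<And>x y z. M x y \<Longrightarrow> N y z \<Longrightarrow> P x z"
  shows "ef lt lt'' P n X Z"
  using assms(1,2)
proof (induction n arbitrary: X Y Z)
  case (Suc n)
  show ?case
  proof (rule ef_SucI)
    fix x assume "x \<in> X"
    then show "\<exists>z\<in>Z. P x z \<and> ef lt lt'' P n (before lt X x) (before lt'' Z z) \<and>
        ef lt lt'' P n (after lt X x) (after lt'' Z z)"
      using assms(3) Suc.IH by (elim ef_SucE1[OF Suc.prems(1)] ef_SucE1[OF Suc.prems(2)]) metis
  next
    fix z assume "z \<in> Z"
    then show "\<exists>x\<in>X. P x z \<and> ef lt lt'' P n (before lt X x) (before lt'' Z z) \<and>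
        ef lt lt'' P n (after lt X x) (after lt'' Z z)"
      using assms(3) Suc.IH by (elim ef_SucE2[OF Suc.prems(2)] ef_SucE2[OF Suc.prems(1)]) metis
  qed
qed simp

text \<open>The map \<open>f\<close> carries the parts before and after \<open>x\<close> onto those
  before and after \<open>f x\<close>, so answering along \<open>f\<close> can be repeated in both
  remaining games.\<close>

lemma ef_iso:
  assumes "f ` X = Y" "\<And>x. x \<in> X \<Longrightarrow> M x (f x)"
    and "\<And>x x'. x \<in> X \<Longrightarrow> x' \<in> X \<Longrightarrow> lt' (f x) (f x') \<longleftrightarrow> lt x x'"
  shows "ef lt lt' M n X Y"
  using assms
proof (induction n arbitrary: X Y)
  case (Suc n)
  have 1: "ef lt lt' M n (before lt X x) (before lt' Y (f x))" if "x \<in> X" for x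
    by (rule Suc.IH) (use that Suc.prems in \<open>auto simp: before_def\<close>)
  have 2: "ef lt lt' M n (after lt X x) (after lt' Y (f x))" if "x \<in> X" for x
    by (rule Suc.IH) (use that Suc.prems in \<open>auto simp: after_def\<close>)
  show ?case
    by (rule ef_SucI) (use 1 2 Suc.prems(1,2) in blast)+
qed simp

lemma ef_refl: "(\<And>x. x \<in> X \<Longrightarrow> M x x) \<Longrightarrow> ef lt lt M n X X"
  by (rule ef_iso[of id]) auto

lemma before_after_Un:
  assumes lx: "lin_on (X1 \<union> X2) lt" and px: "precedes lt X1 X2"
  shows "x \<in> X1 \<Longrightarrow> before lt (X1 \<union> X2) x = before lt X1 x"
    and "x \<in> X1 \<Longrightarrow> after lt (X1 \<union> X2) x = after lt X1 x \<union> X2"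
    and "x \<in> X2 \<Longrightarrow> before lt (X1 \<union> X2) x = X1 \<union> before lt X2 x"
    and "x \<in> X2 \<Longrightarrow> after lt (X1 \<union> X2) x = after lt X2 x"
  using lin_on_asym[OF lx] lin_on_irrefl[OF lx] px unfolding before_def after_def precedes_def by blast+

text \<open>A move is answered inside its own summand. The other summand stays whole and joins one
  of the two remaining games, at one rank less.\<close>

lemma ef_concat:
  assumes "ef lt lt' M n X1 Y1" "ef lt lt' M n X2 Y2"
    and "lin_on (X1 \<union> X2) lt" "precedes lt X1 X2"
    and "lin_on (Y1 \<union> Y2) lt'" "precedes lt' Y1 Y2"
  shows "ef lt lt' M n (X1 \<union> X2) (Y1 \<union> Y2)"
  using assms
proof (induction n arbitrary: X1 X2 Y1 Y2)
  case (Suc n)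
  note X = before_after_Un[OF Suc.prems(3,4)] and Y = before_after_Un[OF Suc.prems(5,6)]
  let ?X = "X1 \<union> X2" and ?Y = "Y1 \<union> Y2"
  let ?ok = "\<lambda>x y. M x y \<and> ef lt lt' M n (before lt ?X x) (before lt' ?Y y) \<and>
        ef lt lt' M n (after lt ?X x) (after lt' ?Y y)"
  have IH: "ef lt lt' M n (U1 \<union> U2) (V1 \<union> V2)"
    if "ef lt lt' M n U1 V1" "ef lt lt' M n U2 V2" "U1 \<subseteq> X1" "U2 \<subseteq> X2" "V1 \<subseteq> Y1" "V2 \<subseteq> Y2"
    for U1 U2 V1 V2
  proof (rule Suc.IH[OF that(1,2)])
    show "lin_on (U1 \<union> U2) lt" by (rule lin_on_subset[OF Suc.prems(3)]) (use that in blast)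
    show "lin_on (V1 \<union> V2) lt'" by (rule lin_on_subset[OF Suc.prems(5)]) (use that in blast)
    show "precedes lt U1 U2" "precedes lt' V1 V2"
      using that Suc.prems(4,6) unfolding precedes_def by blast+
  qed
  have 1: "?ok x y" if "M x y" "x \<in> X1" "y \<in> Y1" "ef lt lt' M n (before lt X1 x) (before lt' Y1 y)"
    "ef lt lt' M n (after lt X1 x) (after lt' Y1 y)" for x y
    using that X(1,2)[of x] Y(1,2)[of y]
      IH[OF that(5) ef_Suc_imp[OF Suc.prems(2)] after_subset order_refl after_subset order_refl]
    by simp
  have 2: "?ok x y" if "M x y" "x \<in> X2" "y \<in> Y2" "ef lt lt' M n (before lt X2 x) (before lt' Y2 y)"
    "ef lt lt' M n (after lt X2 x) (after lt' Y2 y)" for x y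
    using that X(3,4)[of x] Y(3,4)[of y]
      IH[OF ef_Suc_imp[OF Suc.prems(1)] that(4) order_refl before_subset order_refl before_subset]
    by simp
  show ?case
  proof (rule ef_SucI)
    fix x assume "x \<in> ?X"
    then consider "x \<in> X1" | "x \<in> X2" by blast
    then show "\<exists>y\<in>?Y. ?ok x y"
    proof cases
      case x: 1
      show ?thesis by (rule ef_SucE1[OF Suc.prems(1) x]) (use 1 x in blast)
    next
      case x: 2
      show ?thesis by (rule ef_SucE1[OF Suc.prems(2) x]) (use 2 x in blast)
    qed
  next
    fix y assume "y \<in> ?Y"
    then consider "y \<in> Y1" | "y \<in> Y2" by blast
    then show "\<exists>x\<in>?X. ?ok x y"
    proof cases
      case y: 1
      show ?thesis by (rule ef_SucE2[OF Suc.prems(1) y]) (use 1 y in blast)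
    next
      case y: 2
      show ?thesis by (rule ef_SucE2[OF Suc.prems(2) y]) (use 2 y in blast)
    qed
  qed
qed simp

section \<open>Ordered sums of linear orders and finiteness of types\<close>

definition ordered_family :: "('i \<Rightarrow> 'i \<Rightarrow> bool) \<Rightarrow> ('a \<Rightarrow> 'a \<Rightarrow> bool) \<Rightarrow> 'i set \<Rightarrow> ('i \<Rightarrow> 'a set) \<Rightarrow> bool"
  where "ordered_family li lt I F \<longleftrightarrow> lin_on I li \<and> lin_on (\<Union>i\<in>I. F i) lt \<and>
    (\<forall>i\<in>I. \<forall>j\<in>I. li i j \<longrightarrow> precedes lt (F i) (F j))"

lemma ordered_family_subset:
  "ordered_family li lt I F \<Longrightarrow> J \<subseteq> I \<Longrightarrow> ordered_family li lt J F"
  unfolding ordered_family_def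
  using lin_on_subset[of "\<Union>i\<in>I. F i" lt "\<Union>i\<in>J. F i"] lin_on_subset[of I li J] by blast

text \<open>A point cuts only its own block; comparing indices by totality puts every other block
  entirely on one side.\<close>

lemma ordered_family_split:
  assumes "ordered_family li lt I F" "i \<in> I" "x \<in> F i"
  shows "before lt (\<Union>i\<in>I. F i) x = (\<Union>i\<in>before li I i. F i) \<union> before lt (F i) x"
    and "after lt (\<Union>i\<in>I. F i) x = after lt (F i) x \<union> (\<Union>i\<in>after li I i. F i)"
proof -
  have a: "lin_on I li" and l: "lin_on (\<Union>i\<in>I. F i) lt"
    and p: "\<And>i j x y. i \<in> I \<Longrightarrow> j \<in> I \<Longrightarrow> li i j \<Longrightarrow> x \<in> F i \<Longrightarrow> y \<in> F j \<Longrightarrow> lt x y"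
    using assms(1) unfolding ordered_family_def precedes_def by auto
  have "z \<in> F i \<or> li j i" if "j \<in> I" "z \<in> F j" "lt z x" for j z
    using lin_on_total[OF a that(1) assms(2)] p[OF assms(2) that(1) _ assms(3) that(2)]
      lin_on_asym[OF l that(3)] that assms(2,3) by blast
  then show "before lt (\<Union>i\<in>I. F i) x = (\<Union>i\<in>before li I i. F i) \<union> before lt (F i) x"
    using p assms(2,3) unfolding before_def by blast
  have "z \<in> F i \<or> li i j" if "j \<in> I" "z \<in> F j" "lt x z" for j z
    using lin_on_total[OF a that(1) assms(2)] p[OF that(1) assms(2) _ that(2) assms(3)]
      lin_on_asym[OF l that(3)] that assms(2,3) by blast
  then show "after lt (\<Union>i\<in>I. F i) x = after lt (F i) x \<union> (\<Union>i\<in>after li I i. F i)"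
    using p assms(2,3) unfolding after_def by blast
qed

text \<open>Two games are played at once. The index game, with equivalence of blocks in the place of
  colours, leads from the block of a move to an equivalent block, and the game between these two
  blocks supplies the answer. What remains on each side is a smaller sum joined to a part of one
  block, so \<open>ef_concat\<close> applies.\<close>

lemma ef_sum:
  assumes "ef li lj (\<lambda>i j. ef lt lt' M n (F i) (G j)) n I J"
    and "ordered_family li lt I F" "ordered_family lj lt' J G"
  shows "ef lt lt' M n (\<Union>i\<in>I. F i) (\<Union>j\<in>J. G j)"
  using assms
proof (induction n arbitrary: I J)
  case (Suc n)
  let ?E = "\<lambda>k i j. ef lt lt' M k (F i) (G j)"
  let ?X = "\<Union>i\<in>I. F i" and ?Y = "\<Union>j\<in>J. G j"
  let ?ok = "\<lambda>x y. M x y \<and> ef lt lt' M n (before lt ?X x) (before lt' ?Y y) \<and>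
        ef lt lt' M n (after lt ?X x) (after lt' ?Y y)"
  have IH: "ef lt lt' M n (\<Union>i\<in>I'. F i) (\<Union>j\<in>J'. G j)"
    if "ef li lj (?E (Suc n)) n I' J'" "I' \<subseteq> I" "J' \<subseteq> J" for I' J'
  proof (rule Suc.IH)
    \<comment> \<open>The blocks were matched at rank \<open>Suc n\<close>, while the induction
      hypothesis wants them matched at rank \<open>n\<close>.\<close>
    show "ef li lj (?E n) n I' J'"
      by (rule ef_mono_match[OF that(1)]) (rule ef_Suc_imp)
  qed (use ordered_family_subset Suc.prems that in blast)+
  have ok: "?ok x y"
    if ij: "i \<in> I" "j \<in> J" and e: "ef li lj (?E (Suc n)) n (before li I i) (before lj J j)"
      "ef li lj (?E (Suc n)) n (after li I i) (after lj J j)"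
      and xy: "x \<in> F i" "y \<in> G j" "M x y" "ef lt lt' M n (before lt (F i) x) (before lt' (G j) y)"
      "ef lt lt' M n (after lt (F i) x) (after lt' (G j) y)" for i j x y
  proof -
    note X = ordered_family_split[OF Suc.prems(2) ij(1) xy(1)]
      and Y = ordered_family_split[OF Suc.prems(3) ij(2) xy(2)]
    have lX: "lin_on ?X lt" and lY: "lin_on ?Y lt'"
      using Suc.prems(2,3) unfolding ordered_family_def by auto
    have "ef lt lt' M n (before lt ?X x) (before lt' ?Y y)"
      unfolding X Y
    proof (rule ef_concat)
      show "ef lt lt' M n (\<Union> (F ` before li I i)) (\<Union> (G ` before lj J j))"
        by (rule IH[OF e(1) before_subset before_subset])
      show "lin_on (\<Union> (F ` before li I i) \<union> before lt (F i) x) lt"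
        using lin_on_subset[OF lX] X(1) before_subset by metis
      show "lin_on (\<Union> (G ` before lj J j) \<union> before lt' (G j) y) lt'"
        using lin_on_subset[OF lY] Y(1) before_subset by metis
      show "precedes lt (\<Union> (F ` before li I i)) (before lt (F i) x)"
        "precedes lt' (\<Union> (G ` before lj J j)) (before lt' (G j) y)"
        using Suc.prems(2,3) ij unfolding ordered_family_def precedes_def before_def by auto
    qed (rule xy)
    moreover have "ef lt lt' M n (after lt ?X x) (after lt' ?Y y)"
      unfolding X Y
    proof (rule ef_concat)
      show "ef lt lt' M n (\<Union> (F ` after li I i)) (\<Union> (G ` after lj J j))"
        by (rule IH[OF e(2) after_subset after_subset])
      show "lin_on (after lt (F i) x \<union> \<Union> (F ` after li I i)) lt"
        using lin_on_subset[OF lX] X(2) after_subset by metis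
      show "lin_on (after lt' (G j) y \<union> \<Union> (G ` after lj J j)) lt'"
        using lin_on_subset[OF lY] Y(2) after_subset by metis
      show "precedes lt (after lt (F i) x) (\<Union> (F ` after li I i))"
        "precedes lt' (after lt' (G j) y) (\<Union> (G ` after lj J j))"
        using Suc.prems(2,3) ij unfolding ordered_family_def precedes_def after_def by auto
    qed (rule xy)
    ultimately show ?thesis using xy by blast
  qed
  show ?case
  proof (rule ef_SucI)
    fix x assume "x \<in> ?X"
    then obtain i where i: "i \<in> I" "x \<in> F i" by blast
    obtain j where j: "j \<in> J" "?E (Suc n) i j"
      "ef li lj (?E (Suc n)) n (before li I i) (before lj J j)"
      "ef li lj (?E (Suc n)) n (after li I i) (after lj J j)"
      by (rule ef_SucE1[OF Suc.prems(1) i(1)])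
    obtain y where y: "y \<in> G j" "M x y" "ef lt lt' M n (before lt (F i) x) (before lt' (G j) y)"
      "ef lt lt' M n (after lt (F i) x) (after lt' (G j) y)"
      by (rule ef_SucE1[OF j(2) i(2)])
    show "\<exists>y\<in>?Y. ?ok x y" using ok[OF i(1) j(1,3,4) i(2) y] j(1) y(1) by blast
  next
    fix y assume "y \<in> ?Y"
    then obtain j where j: "j \<in> J" "y \<in> G j" by blast
    obtain i where i: "i \<in> I" "?E (Suc n) i j"
      "ef li lj (?E (Suc n)) n (before li I i) (before lj J j)"
      "ef li lj (?E (Suc n)) n (after li I i) (after lj J j)"
      by (rule ef_SucE2[OF Suc.prems(1) j(1)])
    obtain x where x: "x \<in> F i" "M x y" "ef lt lt' M n (before lt (F i) x) (before lt' (G j) y)"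
      "ef lt lt' M n (after lt (F i) x) (after lt' (G j) y)"
      by (rule ef_SucE2[OF i(2) j(2)])
    show "\<exists>x\<in>?X. ?ok x y" using ok[OF i(1) j(1) i(3,4) x(1) j(2) x(2-4)] i(1) x(1) by blast
  qed
qed simp

text \<open>The function \<open>f\<close> numbers types, with \<open>N\<close> as a bound. At the
  next rank a set is classified by the triples that its points realise: colour, type of the part
  before, type of the part after. There are finitely many sets of such triples.\<close>

lemma ef_finite_types:
  assumes "\<And>x. x \<in> X \<Longrightarrow> c x < (d::nat)"
  shows "\<exists>f::'a set \<Rightarrow> nat. \<exists>N. (\<forall>U\<subseteq>X. f U < N) \<and>
    (\<forall>U V. U \<subseteq> X \<longrightarrow> V \<subseteq> X \<longrightarrow> f U = f V \<longrightarrow> ef lt lt (\<lambda>x y. c x = c y) n U V)"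
proof (induction n)
  case 0
  show ?case by (rule exI[of _ "\<lambda>_. 0"], rule exI[of _ 1]) auto
next
  case (Suc n)
  then obtain f :: "'a set \<Rightarrow> nat" and N where
    f: "\<And>U. U \<subseteq> X \<Longrightarrow> f U < N"
    and eq: "\<And>U V. U \<subseteq> X \<Longrightarrow> V \<subseteq> X \<Longrightarrow> f U = f V \<Longrightarrow> ef lt lt (\<lambda>x y. c x = c y) n U V"
    by blast
  define t where "t U x = (c x, f (before lt U x), f (after lt U x))" for U x
  let ?S = "Pow ({..<d} \<times> {..<N} \<times> {..<N})"
  have "finite ?S" by simp
  then obtain h :: "_ \<Rightarrow> nat" where h: "bij_betw h ?S {0..<card ?S}"
    by (rule ex_bij_betw_finite_nat[THEN exE])
  have t: "t U ` U \<in> ?S" if "U \<subseteq> X" for U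
  proof -
    have "t U x \<in> {..<d} \<times> {..<N} \<times> {..<N}" if "x \<in> U" for x
      using assms[of x] that \<open>U \<subseteq> X\<close> f[OF order_trans[OF before_subset \<open>U \<subseteq> X\<close>]]
        f[OF order_trans[OF after_subset \<open>U \<subseteq> X\<close>]]
      unfolding t_def by blast
    then show ?thesis by blast
  qed
  show ?case
  proof (rule exI[of _ "\<lambda>U. h (t U ` U)"], rule exI[of _ "card ?S"], intro conjI allI impI)
    fix U assume "U \<subseteq> X"
    then show "h (t U ` U) < card ?S" using bij_betw_apply[OF h t] by (simp del: card_Pow)
  next
    fix U V assume UV: "U \<subseteq> X" "V \<subseteq> X" "h (t U ` U) = h (t V ` V)"
    then have im: "t U ` U = t V ` V"
      using inj_onD[OF bij_betw_imp_inj_on[OF h]] t by blast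
    have *: "c x = c y \<and> ef lt lt (\<lambda>x y. c x = c y) n (before lt U x) (before lt V y) \<and>
        ef lt lt (\<lambda>x y. c x = c y) n (after lt U x) (after lt V y)" if "t U x = t V y" for x y
      using that eq[OF order_trans[OF before_subset UV(1)] order_trans[OF before_subset UV(2)]]
        eq[OF order_trans[OF after_subset UV(1)] order_trans[OF after_subset UV(2)]]
      unfolding t_def by simp
    show "ef lt lt (\<lambda>x y. c x = c y) (Suc n) U V"
    proof (rule ef_SucI)
      fix x assume "x \<in> U"
      then obtain y where "y \<in> V" "t U x = t V y" using im by blast
      then show "\<exists>y\<in>V. c x = c y \<and> ef lt lt (\<lambda>x y. c x = c y) n (before lt U x) (before lt V y) \<and>
        ef lt lt (\<lambda>x y. c x = c y) n (after lt U x) (after lt V y)" using * by blast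
    next
      fix y assume "y \<in> V"
      then have "t V y \<in> t U ` U" using im by blast
      then obtain x where "x \<in> U" "t U x = t V y" by (metis imageE)
      then show "\<exists>x\<in>U. c x = c y \<and> ef lt lt (\<lambda>x y. c x = c y) n (before lt U x) (before lt V y) \<and>
        ef lt lt (\<lambda>x y. c x = c y) n (after lt U x) (after lt V y)" using * by blast
    qed
  qed
qed

subsection \<open>Soundness for first-order sentences\<close>

text \<open>An empty \<open>A\<close> or \<open>B\<close> leaves its side unbounded.\<close>

definition gap :: "('a \<Rightarrow> 'a \<Rightarrow> bool) \<Rightarrow> 'a set \<Rightarrow> 'a set \<Rightarrow> 'a set \<Rightarrow> 'a set" where
  "gap lt X A B = {x \<in> X. (\<forall>a\<in>A. lt a x) \<and> (\<forall>b\<in>B. lt x b)}"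

definition ef_pairs :: "('a \<Rightarrow> 'a \<Rightarrow> bool) \<Rightarrow> ('b \<Rightarrow> 'b \<Rightarrow> bool) \<Rightarrow> ('a \<Rightarrow> 'b \<Rightarrow> bool) \<Rightarrow> nat \<Rightarrow>
    'a set \<Rightarrow> 'b set \<Rightarrow> ('a \<times> 'b) set \<Rightarrow> bool" where
  "ef_pairs lt lt' M n X Y P \<longleftrightarrow> P \<subseteq> X \<times> Y \<and> (\<forall>p\<in>P. M (fst p) (snd p)) \<and>
    (\<forall>p\<in>P. \<forall>p'\<in>P. lt (fst p) (fst p') \<longleftrightarrow> lt' (snd p) (snd p')) \<and>
    (\<forall>A B. A \<union> B = P \<longrightarrow> ef lt lt' M n (gap lt X (fst ` A) (fst ` B)) (gap lt' Y (snd ` A) (snd ` B)))"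

lemma ef_pairs_Suc_imp: "ef_pairs lt lt' M (Suc n) X Y P \<Longrightarrow> ef_pairs lt lt' M n X Y P"
  unfolding ef_pairs_def by (auto intro: ef_Suc_imp)

lemma ef_pairs_sym:
  assumes "ef_pairs lt lt' M n X Y P"
  shows "ef_pairs lt' lt (\<lambda>y x. M x y) n Y X (prod.swap ` P)"
proof -
  have "ef lt' lt (\<lambda>y x. M x y) n (gap lt' Y (fst ` A) (fst ` B)) (gap lt X (snd ` A) (snd ` B))"
    if "A \<union> B = prod.swap ` P" for A B
  proof -
    have "prod.swap ` A \<union> prod.swap ` B = P"
      using that by (simp add: image_Un[symmetric] image_comp)
    then have "ef lt lt' M n (gap lt X (fst ` prod.swap ` A) (fst ` prod.swap ` B))
       (gap lt' Y (snd ` prod.swap ` A) (snd ` prod.swap ` B))"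
      using assms unfolding ef_pairs_def by blast
    from ef_sym[OF this] show ?thesis by (simp add: image_comp)
  qed
  moreover have "prod.swap ` P \<subseteq> Y \<times> X" "\<forall>p\<in>prod.swap ` P. M (snd p) (fst p)"
    "\<forall>p\<in>prod.swap ` P. \<forall>p'\<in>prod.swap ` P. lt' (fst p) (fst p') \<longleftrightarrow> lt (snd p) (snd p')"
    using assms unfolding ef_pairs_def by auto
  ultimately show ?thesis unfolding ef_pairs_def by blast
qed

text \<open>The possible effects of a new bound \<open>x\<close>: the gap is cut at
  \<open>x\<close>, or it is unchanged because an old bound is stronger, or it becomes empty because
  the bounds conflict.\<close>

lemma gap_insert:
  assumes "lin_on X lt" "x \<in> X" "A \<subseteq> X" "B \<subseteq> X"
  shows gap_insert_left: "gap lt X (insert x A) B = after lt (gap lt X A B) x"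
    and gap_insert_right: "gap lt X A (insert x B) = before lt (gap lt X A B) x"
    and gap_insert_both: "gap lt X (insert x A) (insert x B) = {}"
    and gap_insert_left_redundant: "a \<in> A \<Longrightarrow> lt x a \<Longrightarrow> gap lt X (insert x A) B = gap lt X A B"
    and gap_insert_right_redundant: "b \<in> B \<Longrightarrow> lt b x \<Longrightarrow> gap lt X A (insert x B) = gap lt X A B"
    and gap_insert_left_empty: "b \<in> B \<Longrightarrow> lt b x \<Longrightarrow> gap lt X (insert x A) B = {}"
    and gap_insert_right_empty: "a \<in> A \<Longrightarrow> lt x a \<Longrightarrow> gap lt X A (insert x B) = {}"
proof -
  note asym = lin_on_asym[OF assms(1) _ _ assms(2)]
  have tr: "lt x z" if "lt x y" "lt y z" "y \<in> X" "z \<in> X" for y z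
    using lin_on_trans[OF assms(1) that(1,2) assms(2) that(3,4)] .
  have tr': "lt z x" if "lt z y" "lt y x" "y \<in> X" "z \<in> X" for y z
    using lin_on_trans[OF assms(1) that(1,2) that(4,3) assms(2)] .
  show "gap lt X (insert x A) B = after lt (gap lt X A B) x"
    "gap lt X A (insert x B) = before lt (gap lt X A B) x"
    unfolding gap_def after_def before_def by auto
  show "gap lt X (insert x A) (insert x B) = {}"
    using asym unfolding gap_def by blast
  show "gap lt X (insert x A) B = gap lt X A B" if "a \<in> A" "lt x a"
    using tr[OF that(2)] that(1) assms(3) unfolding gap_def by blast
  show "gap lt X A (insert x B) = gap lt X A B" if "b \<in> B" "lt b x"
    using tr'[OF _ that(2)] that(1) assms(4) unfolding gap_def by blast
  show "gap lt X (insert x A) B = {}" if "b \<in> B" "lt b x"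
    using tr'[OF _ that(2)] that(1) assms(4) asym unfolding gap_def by blast
  show "gap lt X A (insert x B) = {}" if "a \<in> A" "lt x a"
    using tr[OF that(2)] that(1) assms(3) asym unfolding gap_def by blast
qed

lemma ef_empty: "ef lt lt' M n {} {}"
  by (cases n) (auto simp: ef.simps(2))

text \<open>The answer is found in the gap of the cut that \<open>x\<close> makes in
  \<open>P\<close>. This gap is split by the move; every other gap stays as it was or becomes
  empty.\<close>

lemma ef_pairs_extend:
  assumes P: "ef_pairs lt lt' M (Suc n) X Y P" and lX: "lin_on X lt" and lY: "lin_on Y lt'"
    and x: "x \<in> X"
  shows "\<exists>y\<in>Y. ef_pairs lt lt' M n X Y (insert (x, y) P)"
proof (cases "x \<in> fst ` P")
  case True
  \<comment> \<open>A point chosen before keeps its partner.\<close>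
  then obtain y where y: "(x, y) \<in> P" by force
  then have "y \<in> Y" using P unfolding ef_pairs_def by blast
  then show ?thesis using ef_pairs_Suc_imp[OF P] y by (metis insert_absorb)
next
  case False
  define A0 where "A0 = {p \<in> P. lt (fst p) x}"
  define B0 where "B0 = {p \<in> P. lt x (fst p)}"
  have sub: "\<And>p. p \<in> P \<Longrightarrow> fst p \<in> X \<and> snd p \<in> Y" using P unfolding ef_pairs_def by auto
  have gp: "\<And>A B. A \<union> B = P \<Longrightarrow>
      ef lt lt' M (Suc n) (gap lt X (fst ` A) (fst ` B)) (gap lt' Y (snd ` A) (snd ` B))"
    using P unfolding ef_pairs_def by blast
  have P0: "A0 \<union> B0 = P"
  proof -
    have "lt (fst p) x \<or> lt x (fst p)" if "p \<in> P" for p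
      using lin_on_total[OF lX _ x, of "fst p"] sub[OF that] False that by (metis imageI)
    then show ?thesis unfolding A0_def B0_def by blast
  qed
  let ?X = "gap lt X (fst ` A0) (fst ` B0)" and ?Y = "gap lt' Y (snd ` A0) (snd ` B0)"
  have "x \<in> ?X" using x unfolding gap_def A0_def B0_def by auto
  then obtain y where y: "y \<in> ?Y" "M x y" and bf: "ef lt lt' M n (before lt ?X x) (before lt' ?Y y)"
    and af: "ef lt lt' M n (after lt ?X x) (after lt' ?Y y)"
    using gp[OF P0] unfolding ef.simps by blast
  have yY: "y \<in> Y" and yA: "\<And>p. p \<in> A0 \<Longrightarrow> lt' (snd p) y" and yB: "\<And>p. p \<in> B0 \<Longrightarrow> lt' y (snd p)"
    using y(1) unfolding gap_def by auto
  have xA: "\<And>p. p \<in> A0 \<Longrightarrow> lt (fst p) x" and xB: "\<And>p. p \<in> B0 \<Longrightarrow> lt x (fst p)"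
    unfolding A0_def B0_def by auto
  have low: "lt (fst p) x \<longleftrightarrow> lt' (snd p) y" "lt x (fst p) \<longleftrightarrow> lt' y (snd p)" if "p \<in> P" for p
  proof -
    have "p \<in> A0 \<or> p \<in> B0" using that P0 by blast
    moreover have "fst p \<in> X" "snd p \<in> Y" using sub[OF that] by auto
    ultimately show "lt (fst p) x \<longleftrightarrow> lt' (snd p) y" "lt x (fst p) \<longleftrightarrow> lt' y (snd p)"
      using xA[of p] yA[of p] xB[of p] yB[of p] lin_on_asym[OF lX, of "fst p" x]
        lin_on_asym[OF lY, of "snd p" y] x yY by blast+
  qed
  have ord: "lt (fst p) (fst p') \<longleftrightarrow> lt' (snd p) (snd p')"
    if "p \<in> insert (x, y) P" "p' \<in> insert (x, y) P" for p p'
    using that low P lin_on_irrefl[OF lX x] lin_on_irrefl[OF lY yY] unfolding ef_pairs_def by auto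
  have gaps: "ef lt lt' M n (gap lt X (fst ` A) (fst ` B)) (gap lt' Y (snd ` A) (snd ` B))"
    if AB: "A \<union> B = insert (x, y) P" for A B
  proof -
    define A' where "A' = A \<inter> P"
    define B' where "B' = B \<inter> P"
    have AB': "A' \<union> B' = P" using AB unfolding A'_def B'_def by blast
    note g = ef_Suc_imp[OF gp[OF AB']]
    have A: "A = A' \<or> A = insert (x, y) A'" and B: "B = B' \<or> B = insert (x, y) B'"
    proof -
      have "A \<subseteq> insert (x, y) P" "B \<subseteq> insert (x, y) P" using AB by blast+
      then show "A = A' \<or> A = insert (x, y) A'" "B = B' \<or> B = insert (x, y) B'"
        unfolding A'_def B'_def by (cases "(x, y) \<in> A"; cases "(x, y) \<in> B"; blast)+
    qed
    have "(x, y) \<in> A \<union> B" using AB by blast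
    moreover have "(x, y) \<notin> A'" "(x, y) \<notin> B'" using False AB' by force+
    ultimately have AB3: "A = insert (x, y) A' \<and> B = insert (x, y) B' \<or> A = insert (x, y) A' \<and> B = B' \<or>
        A = A' \<and> B = insert (x, y) B'"
      using A B by (metis UnE)
    have sA: "fst ` A' \<subseteq> X" "snd ` A' \<subseteq> Y" and sB: "fst ` B' \<subseteq> X" "snd ` B' \<subseteq> Y"
      using sub AB' by blast+
    note gX = gap_insert[OF lX x sA(1) sB(1)] and gY = gap_insert[OF lY yY sA(2) sB(2)]
    have disj: "A0 \<inter> B0 = {}"
      using lin_on_asym[OF lX _ _ x] sub unfolding A0_def B0_def by blast
    have cut: "A' = A0" "B' = B0" if "A' \<inter> B0 = {}" "B' \<inter> A0 = {}"
      using that P0 AB' disj by blast+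
    show ?thesis
    \<comment> \<open>If some point below \<open>x\<close> is an upper bound, or some point above
      \<open>x\<close> is a lower bound, then \<open>x\<close> is redundant on one side and empties
      the gap on the other. Otherwise the old cover is the cut at \<open>x\<close>, where the two
      games left over by the move are available.\<close>
    proof (cases "\<exists>p\<in>B'. p \<in> A0")
      case True
      then obtain p where p: "p \<in> B'" "lt (fst p) x" "lt' (snd p) y" using xA yA by blast
      have "fst p \<in> fst ` B'" "snd p \<in> snd ` B'" using p(1) by auto
      note X = gX(5,6)[OF this(1) p(2)] and Y = gY(5,6)[OF this(2) p(3)]
      show ?thesis
        using AB3 by (elim disjE conjE) (simp_all only: image_insert fst_conv snd_conv gX(3) gY(3) X Y g ef_empty)
    next
      case no1: False
      show ?thesis
      proof (cases "\<exists>p\<in>A'. p \<in> B0")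
        case True
        then obtain p where p: "p \<in> A'" "lt x (fst p)" "lt' y (snd p)" using xB yB by blast
        have "fst p \<in> fst ` A'" "snd p \<in> snd ` A'" using p(1) by auto
        note X = gX(4,7)[OF this(1) p(2)] and Y = gY(4,7)[OF this(2) p(3)]
        show ?thesis
        using AB3 by (elim disjE conjE) (simp_all only: image_insert fst_conv snd_conv gX(3) gY(3) X Y g ef_empty)
      next
        case False
        then have "A' = A0" "B' = B0" using no1 cut by blast+
        then show ?thesis using AB3 af bf gX(1-3) gY(1-3)
          by (elim disjE conjE) (simp_all only: image_insert fst_conv snd_conv ef_empty)
      qed
    qed
  qed
  have "ef_pairs lt lt' M n X Y (insert (x, y) P)"
    unfolding ef_pairs_def
  proof (intro conjI)
    show "insert (x, y) P \<subseteq> X \<times> Y" "\<forall>p\<in>insert (x, y) P. M (fst p) (snd p)"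
      using P x yY y(2) unfolding ef_pairs_def by auto
  qed (use ord gaps in blast)+
  then show ?thesis using yY by blast
qed

lemma ef_pairs_extend_right:
  assumes P: "ef_pairs lt lt' M (Suc n) X Y P" and lX: "lin_on X lt" and lY: "lin_on Y lt'"
    and y: "y \<in> Y"
  shows "\<exists>x\<in>X. ef_pairs lt lt' M n X Y (insert (x, y) P)"
proof -
  obtain x where x: "x \<in> X" "ef_pairs lt' lt (\<lambda>y x. M x y) n Y X (insert (y, x) (prod.swap ` P))"
    using ef_pairs_extend[OF ef_pairs_sym[OF P] lY lX y] by blast
  show ?thesis using ef_pairs_sym[OF x(2)] x(1) by (auto simp: image_comp)
qed

definition strict :: "'a rel \<Rightarrow> 'a \<Rightarrow> 'a \<Rightarrow> bool" where
  "strict r x y \<longleftrightarrow> (x, y) \<in> r \<and> x \<noteq> y"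

text \<open>In the recursion for formulas \<open>P\<close> is the set of pairs of elements chosen so far; a reassigned
  variable leaves its old pair in \<open>P\<close>, so \<open>P\<close> is not the graph of the current assignments.\<close>

lemma ef_pairs_sat:
  assumes "ef_pairs (strict r) (strict s) M (qr \<phi>) (Field r) (Field s) P"
    and "lin_on (Field r) (strict r)" "lin_on (Field s) (strict s)"
    and "\<And>v. v \<in> fv \<phi> \<Longrightarrow> (e v, e' v) \<in> P" "colors \<phi> \<subseteq> {..<d}"
    and M: "\<And>x y i. x \<in> Field r \<Longrightarrow> y \<in> Field s \<Longrightarrow> M x y \<Longrightarrow> i < d \<Longrightarrow> x \<in> C i \<longleftrightarrow> y \<in> D i"
  shows "sat r C e \<phi> \<longleftrightarrow> sat s D e' \<phi>"
proof -
  have mono: "ef_pairs (strict r) (strict s) M m (Field r) (Field s) P"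
    if "ef_pairs (strict r) (strict s) M n (Field r) (Field s) P" "m \<le> n" for m n P
    using that(2,1) by (induction rule: dec_induct) (auto dest: ef_pairs_Suc_imp)
  have ord: "strict r (fst p) (fst p') \<longleftrightarrow> strict s (snd p) (snd p')"
    if "ef_pairs (strict r) (strict s) M n (Field r) (Field s) P" "p \<in> P" "p' \<in> P" for n P p p'
    using that unfolding ef_pairs_def by blast
  show ?thesis
    using assms(1,4,5)
  proof (induction \<phi> arbitrary: P e e')
    case (Eq v w)
    then have P: "(e v, e' v) \<in> P" "(e w, e' w) \<in> P" by auto
    then have "e v \<in> Field r" "e w \<in> Field r" "e' v \<in> Field s" "e' w \<in> Field s"
      using Eq.prems(1) unfolding ef_pairs_def by auto
    moreover have "strict r (e v) (e w) \<longleftrightarrow> strict s (e' v) (e' w)"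
      "strict r (e w) (e v) \<longleftrightarrow> strict s (e' w) (e' v)"
      using ord[OF Eq.prems(1) P] ord[OF Eq.prems(1) P(2,1)] by simp_all
    \<comment> \<open>In a linear order equality is incomparability, so preserving the order in both
      directions decides it.\<close>
    ultimately have "e v = e w \<longleftrightarrow> e' v = e' w"
      using assms(2,3) unfolding lin_on_def by metis
    then show ?case by simp
  next
    case (Less v w)
    then have P: "(e v, e' v) \<in> P" "(e w, e' w) \<in> P" by auto
    have "strict r (e v) (e w) \<longleftrightarrow> strict s (e' v) (e' w)"
      using ord[OF Less.prems(1) P] by simp
    then show ?case by (simp add: strict_def)
  next
    case (Col i v)
    then have "(e v, e' v) \<in> P" by auto
    then have "M (e v) (e' v)" "e v \<in> Field r" "e' v \<in> Field s"
      using Col.prems(1) unfolding ef_pairs_def by auto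
    then show ?case using M Col.prems(3) by simp
  next
    case (Neg \<phi>)
    then show ?case by simp
  next
    case (Conj \<phi> \<psi>)
    have "sat r C e \<phi> \<longleftrightarrow> sat s D e' \<phi>"
      by (rule Conj.IH(1)) (use Conj.prems in \<open>auto intro: mono[OF Conj.prems(1)]\<close>)
    moreover have "sat r C e \<psi> \<longleftrightarrow> sat s D e' \<psi>"
      by (rule Conj.IH(2)) (use Conj.prems in \<open>auto intro: mono[OF Conj.prems(1)]\<close>)
    ultimately show ?case by simp
  next
    case (Ex v \<phi>)
    have *: "sat r C (e(v := x)) \<phi> \<longleftrightarrow> sat s D (e'(v := y)) \<phi>"
      if "ef_pairs (strict r) (strict s) M (qr \<phi>) (Field r) (Field s) (insert (x, y) P)" for x y
      by (rule Ex.IH[OF that]) (use Ex.prems in auto)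
    have "\<exists>y\<in>Field s. sat r C (e(v := x)) \<phi> \<longleftrightarrow> sat s D (e'(v := y)) \<phi>" if "x \<in> Field r" for x
      using ef_pairs_extend[OF Ex.prems(1)[unfolded qr.simps] assms(2,3) that] * by blast
    moreover have "\<exists>x\<in>Field r. sat r C (e(v := x)) \<phi> \<longleftrightarrow> sat s D (e'(v := y)) \<phi>" if "y \<in> Field s" for y
      using ef_pairs_extend_right[OF Ex.prems(1)[unfolded qr.simps] assms(2,3) that] * by blast
    ultimately show ?case by auto
  qed simp
qed

text \<open>Play starts from the empty position, whose only gap is the whole order.\<close>

lemma ef_imp_fo_equiv:
  assumes e: "ef (strict r) (strict s) M q (Field r) (Field s)"
    and "lin_on (Field r) (strict r)" "lin_on (Field s) (strict s)"
    and "\<And>x y i. x \<in> Field r \<Longrightarrow> y \<in> Field s \<Longrightarrow> M x y \<Longrightarrow> i < d \<Longrightarrow> x \<in> C i \<longleftrightarrow> y \<in> D i"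
  shows "fo_equiv d q r C s D"
  unfolding fo_equiv_def
proof (intro allI impI)
  fix \<phi> assume \<phi>: "sentence d \<phi> \<and> qr \<phi> \<le> q"
  have "ef (strict r) (strict s) M (qr \<phi>) (Field r) (Field s)"
    using ef_mono_rank[OF e] \<phi> by blast
  then have "ef_pairs (strict r) (strict s) M (qr \<phi>) (Field r) (Field s) {}"
    by (auto simp: ef_pairs_def gap_def)
  from ef_pairs_sat[OF this assms(2,3), of _ _ d C D]
  have "sat r C e \<phi> \<longleftrightarrow> sat s D e' \<phi>" for e e'
    using \<phi> assms(4) unfolding sentence_def by simp
  then show "models r C \<phi> \<longleftrightarrow> models s D \<phi>"
    unfolding models_def by blast
qed

subsection \<open>Skolem functions and closed initial segments\<close>

text \<open>Once \<open>x\<close> bounds one side, the old bound there follows by transitivity.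
  Hence gaps with at most one bound on each side are closed under moves, and Skolem functions need
  only two optional arguments from the structure.\<close>

lemma gap_split:
  assumes "lin_on X lt" "set_option a \<subseteq> X" "set_option b \<subseteq> X"
    and "x \<in> gap lt X (set_option a) (set_option b)"
  shows "before lt (gap lt X (set_option a) (set_option b)) x = gap lt X (set_option a) {x}"
    and "after lt (gap lt X (set_option a) (set_option b)) x = gap lt X {x} (set_option b)"
proof -
  have x: "x \<in> X" "\<And>u. u \<in> set_option a \<Longrightarrow> lt u x" "\<And>u. u \<in> set_option b \<Longrightarrow> lt x u"
    using assms(4) unfolding gap_def by auto
  show "before lt (gap lt X (set_option a) (set_option b)) x = gap lt X (set_option a) {x}"
    using x(3) lin_on_trans[OF assms(1) _ x(3) _ x(1)] assms(3) unfolding gap_def before_def by blast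
  show "after lt (gap lt X (set_option a) (set_option b)) x = gap lt X {x} (set_option b)"
    using x(2) lin_on_trans[OF assms(1) x(2) _ _ x(1)] assms(2) unfolding gap_def after_def by blast
qed

text \<open>Here \<open>None\<close> stands for a missing bound, which \<open>set_option\<close>
  turns into the empty set.\<close>

definition opts :: "'a set \<Rightarrow> 'a option set" where
  "opts Z = insert None (Some ` Z)"

definition skolem_image :: "('a option \<times> 'a option \<times> nat \<Rightarrow> 'a) \<Rightarrow> 'a set \<Rightarrow> 'a set" where
  "skolem_image H Z = H ` (opts Z \<times> opts Z \<times> UNIV)"

text \<open>Elementarity in game form, for intervals with endpoints in \<open>Z\<close>; this covers
  the initial segments and tails used later.\<close>

definition elementary :: "('a \<Rightarrow> 'a \<Rightarrow> bool) \<Rightarrow> ('a \<Rightarrow> nat) \<Rightarrow> 'a set \<Rightarrow> 'a set \<Rightarrow> bool" where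
  "elementary lt c Z X \<longleftrightarrow> (\<forall>n. \<forall>a\<in>opts Z. \<forall>b\<in>opts Z. ef lt lt (\<lambda>x y. c x = c y) n
    (gap lt Z (set_option a) (set_option b)) (gap lt X (set_option a) (set_option b)))"

text \<open>A Tarski-Vaught argument. In each gap \<open>H\<close> chooses a point for every
  realised code of rank, colour and types. Since types of each rank are numbered, natural numbers
  suffice as codes, so a closed set contains a substitute for every point of
  \<open>X\<close>.\<close>

lemma skolem_functions:
  fixes c :: "'a \<Rightarrow> nat"
  assumes lX: "lin_on X lt" and ne: "X \<noteq> {}" and c: "\<And>x. x \<in> X \<Longrightarrow> c x < d"
  obtains H where "range H \<subseteq> X"
    and "\<And>Z. Z \<subseteq> X \<Longrightarrow> skolem_image H Z \<subseteq> Z \<Longrightarrow> elementary lt c Z X"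
proof -
  let ?M = "\<lambda>x y. c x = c y"
  have "\<forall>n. \<exists>f::'a set \<Rightarrow> nat. \<forall>U V. U \<subseteq> X \<longrightarrow> V \<subseteq> X \<longrightarrow> f U = f V \<longrightarrow> ef lt lt ?M n U V"
  proof
    fix n
    obtain f N where "(\<forall>U\<subseteq>X. f U < (N::nat)) \<and>
        (\<forall>U V. U \<subseteq> X \<longrightarrow> V \<subseteq> X \<longrightarrow> f U = f V \<longrightarrow> ef lt lt ?M n U V)"
      using ef_finite_types[where X = X and c = c and d = d and n = n and lt = lt] c by auto
    then show "\<exists>f::'a set \<Rightarrow> nat. \<forall>U V. U \<subseteq> X \<longrightarrow> V \<subseteq> X \<longrightarrow> f U = f V \<longrightarrow> ef lt lt ?M n U V"
      by (intro exI[of _ f]) (rule conjunct2)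
  qed
  from choice[OF this] obtain f :: "nat \<Rightarrow> 'a set \<Rightarrow> nat" where
    f: "\<And>n U V. U \<subseteq> X \<Longrightarrow> V \<subseteq> X \<Longrightarrow> f n U = f n V \<Longrightarrow> ef lt lt ?M n U V" by blast
  obtain x0 where x0: "x0 \<in> X" using ne by blast
  \<comment> \<open>The code of a candidate \<open>z\<close>: the rank, its colour, and the types of
    the two parts into which it cuts the gap, all computed in \<open>X\<close>.\<close>
  define t where "t n a b z = (n, c z, f n (gap lt X (set_option a) {z}), f n (gap lt X {z} (set_option b)))"
    for n a b z
  \<comment> \<open>The rank is the first component of the code, so it can be recovered from
    \<open>k\<close> and need not be a further argument.\<close>
  define W where "W a b k z \<longleftrightarrow> z \<in> gap lt X (set_option a) (set_option b) \<and>
      to_nat (t (fst (from_nat k :: nat \<times> nat \<times> nat \<times> nat)) a b z) = k" for a b k z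
  \<comment> \<open>The default \<open>x0\<close> for unrealised codes keeps the range of
    \<open>H\<close> inside \<open>X\<close>.\<close>
  define H where "H p = (case p of (a, b, k) \<Rightarrow> if \<exists>z. W a b k z then SOME z. W a b k z else x0)" for p
  have Hw: "W a b k (H (a, b, k))" if "W a b k z" for a b k z
    using that someI_ex[of "W a b k"] unfolding H_def by auto
  have gap_sub: "gap lt X A B \<subseteq> X" for A B unfolding gap_def by blast
  have "H (a, b, k) \<in> X" for a b k
  proof (cases "\<exists>z. W a b k z")
    case True
    then show ?thesis using Hw gap_sub unfolding W_def by blast
  next
    case False
    then show ?thesis unfolding H_def prod.case by (simp only: if_not_P x0 not_False_eq_True)
  qed
  then have "range H \<subseteq> X" by auto
  moreover have "ef lt lt ?M n (gap lt Z (set_option a) (set_option b)) (gap lt X (set_option a) (set_option b))"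
    if Z: "Z \<subseteq> X" "skolem_image H Z \<subseteq> Z" and ab: "a \<in> opts Z" "b \<in> opts Z" for Z n a b
    using ab
  proof (induction n arbitrary: a b)
    case (Suc n)
    let ?Z = "gap lt Z (set_option a) (set_option b)" and ?X = "gap lt X (set_option a) (set_option b)"
    have sZ: "set_option a \<subseteq> Z" "set_option b \<subseteq> Z" using Suc.prems unfolding opts_def by auto
    then have sX: "set_option a \<subseteq> X" "set_option b \<subseteq> X" using Z(1) by auto
    have ZX: "?Z = Z \<inter> ?X" using Z(1) unfolding gap_def by blast
    have IH: "ef lt lt ?M n (before lt ?Z z) (before lt ?X z)" "ef lt lt ?M n (after lt ?Z z) (after lt ?X z)"
      if "z \<in> ?Z" for z
    proof -
      have z: "z \<in> Z" "z \<in> ?X" using that ZX by auto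
      then have "Some z \<in> opts Z" unfolding opts_def by blast
      then show "ef lt lt ?M n (before lt ?Z z) (before lt ?X z)" "ef lt lt ?M n (after lt ?Z z) (after lt ?X z)"
        using Suc.IH[OF Suc.prems(1), of "Some z"] Suc.IH[OF _ Suc.prems(2), of "Some z"]
          gap_split[OF lX sX z(2)] gap_split[OF lin_on_subset[OF lX Z(1)] sZ that] by simp_all
    qed
    show ?case
    proof (rule ef_SucI)
      fix z assume "z \<in> ?Z"
      then show "\<exists>x\<in>?X. c z = c x \<and> ef lt lt ?M n (before lt ?Z z) (before lt ?X x) \<and>
          ef lt lt ?M n (after lt ?Z z) (after lt ?X x)"
        using IH ZX by blast
    next
      fix x assume x: "x \<in> ?X"
      \<comment> \<open>A point of \<open>Z\<close> answers itself. A point \<open>x\<close> of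
        \<open>X\<close> is replaced by the value of \<open>H\<close> with the same code, which lies
        in \<open>Z\<close> and is then compared with itself by induction.\<close>
      define k where "k = to_nat (t n a b x)"
      define z where "z = H (a, b, k)"
      have "W a b k x" using x unfolding W_def k_def t_def by simp
      from Hw[OF this] have w: "W a b k z" unfolding z_def .
      have "z \<in> Z" using Z(2) Suc.prems unfolding z_def skolem_image_def by blast
      moreover have zX: "z \<in> ?X" using w unfolding W_def by blast
      ultimately have zZ: "z \<in> ?Z" using ZX by blast
      have "to_nat (t n a b z) = to_nat (t n a b x)"
        using w unfolding W_def by (simp add: k_def t_def)
      then have "t n a b z = t n a b x" by simp
      then have zx: "c z = c x" "ef lt lt ?M n (before lt ?X z) (before lt ?X x)"
        "ef lt lt ?M n (after lt ?X z) (after lt ?X x)"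
        unfolding gap_split[OF lX sX zX] gap_split[OF lX sX x]
        by (auto simp: t_def intro!: f[OF gap_sub gap_sub])
      have "ef lt lt ?M n (before lt ?Z z) (before lt ?X x)"
        by (rule ef_trans[OF IH(1)[OF zZ] zx(2)]) simp
      moreover have "ef lt lt ?M n (after lt ?Z z) (after lt ?X x)"
        by (rule ef_trans[OF IH(2)[OF zZ] zx(3)]) simp
      ultimately show "\<exists>z\<in>?Z. c z = c x \<and> ef lt lt ?M n (before lt ?Z z) (before lt ?X x) \<and>
          ef lt lt ?M n (after lt ?Z z) (after lt ?X x)"
        using zZ zx(1) by blast
    qed
  qed simp
  ultimately show ?thesis unfolding elementary_def[abs_def] by (intro that[of H, unfolded elementary_def]) blast+
qed

text \<open>Two bounds from the union occur together at some stage, and the next stage contains the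
  values of \<open>H\<close> at them. This serves both for hulls and for limits of closed
  segments.\<close>

lemma skolem_image_chain:
  assumes "\<And>n. Z n \<subseteq> Z (Suc n)" "\<And>n. skolem_image H (Z n) \<subseteq> Z (Suc n)"
  shows "skolem_image H (\<Union>n. Z n) \<subseteq> (\<Union>n. Z n)"
proof -
  have mono: "Z m \<subseteq> Z n" if "m \<le> n" for m n
    using lift_Suc_mono_le[of Z, OF assms(1) that] .
  have opts_mono: "opts (Z m) \<subseteq> opts (Z n)" if "m \<le> n" for m n
    using mono[OF that] unfolding opts_def by blast
  have opts_chain: "\<exists>n. a \<in> opts (Z n)" if "a \<in> opts (\<Union>n. Z n)" for a
    using that unfolding opts_def by blast
  have "H (a, b, k) \<in> (\<Union>n. Z n)" if a: "a \<in> opts (\<Union>n. Z n)" and b: "b \<in> opts (\<Union>n. Z n)" for a b k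
  proof -
    obtain m where "a \<in> opts (Z m)" using opts_chain[OF a] by blast
    moreover obtain n where "b \<in> opts (Z n)" using opts_chain[OF b] by blast
    ultimately have "a \<in> opts (Z (max m n))" "b \<in> opts (Z (max m n))"
      using opts_mono[of m "max m n"] opts_mono[of n "max m n"] by auto
    then have "H (a, b, k) \<in> skolem_image H (Z (max m n))" unfolding skolem_image_def by blast
    then show ?thesis using assms(2) by blast
  qed
  then show ?thesis unfolding skolem_image_def by blast
qed

text \<open>Downward Loewenheim-Skolem: \<open>H\<close> is applied in omega rounds, each of which
  preserves countability.\<close>

lemma countable_skolem_hull:
  assumes "range H \<subseteq> X" "countable Y" "Y \<subseteq> X"
  obtains Z where "countable Z" "Y \<subseteq> Z" "Z \<subseteq> X" "skolem_image H Z \<subseteq> Z"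
proof
  define Z where "Z = rec_nat Y (\<lambda>_ U. U \<union> skolem_image H U)"
  have Z: "Z 0 = Y" "\<And>n. Z (Suc n) = Z n \<union> skolem_image H (Z n)" unfolding Z_def by auto
  have "countable (skolem_image H U)" if "countable U" for U
    unfolding skolem_image_def opts_def using that by (intro countable_image countable_SIGMA) auto
  moreover have "skolem_image H U \<subseteq> X" for U
    unfolding skolem_image_def using assms(1) by blast
  ultimately have "countable (Z n) \<and> Z n \<subseteq> X" for n
    by (induction n) (use assms in \<open>auto simp: Z\<close>)
  then show "countable (\<Union>n. Z n)" "(\<Union>n. Z n) \<subseteq> X" by auto
  show "Y \<subseteq> (\<Union>n. Z n)" using Z(1) by blast
  show "skolem_image H (\<Union>n. Z n) \<subseteq> (\<Union>n. Z n)"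
    by (rule skolem_image_chain) (auto simp: Z)
qed

section \<open>Bounds, limits and closed segments in regular cardinals\<close>

lemma lin_on_strict: "Well_order r \<Longrightarrow> lin_on (Field r) (strict r)"
  unfolding lin_on_def strict_def order_on_defs total_on_def by (auto dest: antisymD transD)

lemma wfp_strict: "Well_order r \<Longrightarrow> wfp (strict r)"
  unfolding well_order_on_def strict_def wfp_def
  by (auto simp: set_diff_eq elim!: wf_subset)

lemma strict_Field: "strict r x y \<Longrightarrow> x \<in> Field r \<and> y \<in> Field r"
  unfolding strict_def by (auto intro: FieldI1 FieldI2)

lemma infinite_Field_natLeq_less: "natLeq <o r \<Longrightarrow> \<not> finite (Field r)"
  by (metis cinfinite_def cinfinite_mono natLeq_cinfinite ordLess_imp_ordLeq)

lemma regularCard_bounded: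
  assumes r: "Card_order r" "regularCard r" "natLeq <o r" and K: "K \<subseteq> Field r" "|K| <o r"
  shows "\<exists>b\<in>Field r. \<forall>x\<in>K. strict r x b"
proof -
  have wo: "Well_order r" using r(1) unfolding card_order_on_def by blast
  have inf: "\<not> finite (Field r)"
    using r(3) by (rule infinite_Field_natLeq_less)
  have "\<not> cofinal K r"
    using r(2) K not_ordLess_ordIso unfolding regularCard_def by blast
  then obtain a where a: "a \<in> Field r" "\<And>x. x \<in> K \<Longrightarrow> a = x \<or> (a, x) \<notin> r"
    unfolding cofinal_def by blast
  \<comment> \<open>Elements of \<open>K\<close> may still equal \<open>a\<close>; a larger
    \<open>b\<close> makes the bound strict.\<close>
  obtain b where b: "b \<in> Field r" "a \<noteq> b" "(a, b) \<in> r"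
    using infinite_Card_order_limit[OF r(1) inf a(1)] by blast
  have "strict r x b" if "x \<in> K" for x
    using lin_on_total[OF lin_on_strict[OF wo] a(1), of x] lin_on_trans[OF lin_on_strict[OF wo], of x a b]
      a b that K(1) unfolding strict_def by blast
  then show ?thesis using b(1) by blast
qed

text \<open>The range is countable, hence bounded in an uncountable regular cardinal. The limit is
  the least strict bound, so every point below it is below a term of the sequence.\<close>

lemma increasing_sequence_limit:
  assumes r: "Card_order r" "regularCard r" "natLeq <o r"
    and s: "\<And>n::nat. strict r (s n) (s (Suc n))"
  obtains \<delta> where "\<delta> \<in> Field r" "\<And>n. strict r (s n) \<delta>"
    and "before (strict r) (Field r) \<delta> = (\<Union>n. before (strict r) (Field r) (s n))"
proof -
  have wo: "Well_order r" using r(1) unfolding card_order_on_def by blast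
  note lin = lin_on_strict[OF wo]
  have sF: "s n \<in> Field r" for n using strict_Field[OF s] by blast
  have "|range s| \<le>o natLeq"
    using card_of_image[of s UNIV] card_of_nat ordLeq_ordIso_trans by blast
  then have "|range s| <o r" using r(3) ordLeq_ordLess_trans by blast
  then have "\<exists>b\<in>Field r. \<forall>x\<in>range s. strict r x b"
    using regularCard_bounded[OF r] sF by blast
  then obtain b where "b \<in> {b \<in> Field r. \<forall>n. strict r (s n) b}" by blast
  then obtain \<delta> where \<delta>: "\<delta> \<in> Field r" "\<And>n. strict r (s n) \<delta>"
    and min: "\<And>y. strict r y \<delta> \<Longrightarrow> y \<notin> {b \<in> Field r. \<forall>n. strict r (s n) b}"
    by (rule wfE_min[OF wfp_strict[OF wo, unfolded wfp_def]]) auto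
  have "\<exists>n. strict r x (s n)" if x\<delta>: "strict r x \<delta>" for x
  proof -
    have x: "x \<in> Field r" using strict_Field[OF x\<delta>] by blast
    then obtain n where "\<not> strict r (s n) x" using min[OF x\<delta>] by blast
    then have "x = s n \<or> strict r x (s n)" using lin_on_total[OF lin sF[of n] x] by auto
    then show ?thesis using s by blast
  qed
  moreover have "strict r x \<delta>" if "strict r x (s n)" for x n
    using lin_on_trans[OF lin that \<delta>(2)] strict_Field[OF that] \<delta>(1) by blast
  ultimately have "before (strict r) (Field r) \<delta> = (\<Union>n. before (strict r) (Field r) (s n))"
    unfolding before_def by blast
  then show ?thesis using \<delta> that by blast
qed

lemma card_of_Times_less:
  fixes A :: "'a set" and B :: "'b set"
  assumes r: "natLeq <o r" and A: "|A| <o r" and B: "|B| <o r"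
  shows "|A \<times> B| <o r"
proof (cases "finite (A \<times> B)")
  case True
  then show ?thesis using finite_iff_ordLess_natLeq r ordLess_transitive by blast
next
  case False
  then have ne: "A \<noteq> {}" "B \<noteq> {}" and inf: "infinite A \<or> infinite B" by auto
  have "|A| \<le>o |B| \<or> |B| \<le>o |A|" by (rule ordLeq_total) (rule card_of_Well_order)+
  then show ?thesis
  proof
    assume le: "|A| \<le>o |B|"
    then have "infinite B" using inf card_of_ordLeq_finite[OF le] by blast
    from card_of_Times_infinite[OF this ne(1) le] have "|A \<times> B| =o |B|" by blast
    then show ?thesis using B by (rule ordIso_ordLess_trans)
  next
    assume le: "|B| \<le>o |A|"
    then have "infinite A" using inf card_of_ordLeq_finite[OF le] by blast
    from card_of_Times_infinite[OF this ne(2) le] have "|A \<times> B| =o |A|" by blast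
    then show ?thesis using A by (rule ordIso_ordLess_trans)
  qed
qed

lemma card_of_skolem_image_less:
  fixes Z :: "'a set"
  assumes r: "Card_order r" "natLeq <o r" and Z: "|Z| <o r"
  shows "|skolem_image H Z| <o r"
proof -
  have inf: "\<not> finite (Field r)"
    using r(2) by (rule infinite_Field_natLeq_less)
  have nat: "|UNIV :: nat set| <o r" using card_of_nat r(2) ordIso_ordLess_trans by blast
  have "|Some ` Z| <o r" using Z card_of_image ordLeq_ordLess_trans by blast
  moreover have "|{None} :: 'a option set| <o r"
    using finite_iff_ordLess_natLeq r(2) ordLess_transitive by blast
  ultimately have "|opts Z| <o r"
    unfolding opts_def insert_is_Un[of None "Some ` Z"]
    using card_of_Un_ordLess_infinite_Field[OF inf r(1)] by blast
  then have "|opts Z \<times> opts Z \<times> (UNIV :: nat set)| <o r"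
    by (intro card_of_Times_less[OF r(2)] nat)
  then show ?thesis
    unfolding skolem_image_def using card_of_image ordLeq_ordLess_trans by blast
qed

text \<open>Proper initial segments of a cardinal are small, and so are their images under
  \<open>H\<close>; regularity bounds these images. Taking such bounds omega times and passing to
  the limit closes the segment.\<close>

lemma closed_segment_above:
  assumes r: "Card_order r" "regularCard r" "natLeq <o r"
    and H: "range H \<subseteq> Field r" and a: "a \<in> Field r"
  obtains \<delta> where "strict r a \<delta>"
    and "skolem_image H (before (strict r) (Field r) \<delta>) \<subseteq> before (strict r) (Field r) \<delta>"
proof -
  have wo: "Well_order r" using r(1) unfolding card_order_on_def by blast
  note lin = lin_on_strict[OF wo]
  let ?B = "before (strict r) (Field r)"
  have inf: "\<not> finite (Field r)"
    using r(3) by (rule infinite_Field_natLeq_less)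
  have ex: "\<exists>y. strict r x y \<and> skolem_image H (?B x) \<subseteq> ?B y" if x: "x \<in> Field r" for x
  proof -
    have "?B x = underS r x"
      unfolding before_def underS_def strict_def by (auto intro: FieldI1)
    then have "|?B x| <o r" using card_of_underS[OF r(1) x] by simp
    then have "|skolem_image H (?B x)| <o r" by (rule card_of_skolem_image_less[OF r(1,3)])
    moreover have "|{x}| <o r"
      using finite_iff_ordLess_natLeq r(3) ordLess_transitive by blast
    ultimately have "|{x} \<union> skolem_image H (?B x)| <o r"
      using card_of_Un_ordLess_infinite_Field[OF inf r(1)] by blast
    moreover have im: "skolem_image H (?B x) \<subseteq> Field r" using H unfolding skolem_image_def by blast
    ultimately obtain y where "\<forall>z\<in>{x} \<union> skolem_image H (?B x). strict r z y"
      using regularCard_bounded[OF r, of "{x} \<union> skolem_image H (?B x)"] x by blast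
    then show ?thesis using im unfolding before_def by blast
  qed
  define g where "g x = (SOME y. strict r x y \<and> skolem_image H (?B x) \<subseteq> ?B y)" for x
  have g: "strict r x (g x) \<and> skolem_image H (?B x) \<subseteq> ?B (g x)" if "x \<in> Field r" for x
    unfolding g_def by (rule someI_ex[OF ex[OF that]])
  define s where "s n = (g ^^ n) a" for n
  have gF: "g x \<in> Field r" if "x \<in> Field r" for x using strict_Field[OF conjunct1[OF g[OF that]]] by simp
  have sF: "s n \<in> Field r" for n
    by (induction n) (simp_all add: s_def a gF)
  have s: "strict r (s n) (s (Suc n))" "skolem_image H (?B (s n)) \<subseteq> ?B (s (Suc n))" for n
    using g[OF sF[of n]] unfolding s_def by auto
  obtain \<delta> where \<delta>: "\<delta> \<in> Field r" "\<And>n. strict r (s n) \<delta>" "?B \<delta> = (\<Union>n. ?B (s n))"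
    by (rule increasing_sequence_limit[OF r, of s]) (auto intro: s(1))
  have "?B (s n) \<subseteq> ?B (s (Suc n))" for n
    unfolding before_def using lin_on_trans[OF lin _ s(1) _ sF sF] by blast
  then have "skolem_image H (?B \<delta>) \<subseteq> ?B \<delta>"
    unfolding \<delta>(3) by (rule skolem_image_chain) (rule s(2))
  then show ?thesis using that \<delta>(2)[of 0] unfolding s_def by simp
qed

subsection \<open>Orders absorbing their multiples\<close>

definition ico :: "('a \<Rightarrow> 'a \<Rightarrow> bool) \<Rightarrow> 'a set \<Rightarrow> 'a \<Rightarrow> 'a \<Rightarrow> 'a set" where
  "ico lt X a b = {x \<in> X. (x = a \<or> lt a x) \<and> lt x b}"

definition from_on :: "('a \<Rightarrow> 'a \<Rightarrow> bool) \<Rightarrow> 'a set \<Rightarrow> 'a \<Rightarrow> 'a set" where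
  "from_on lt X a = {x \<in> X. x = a \<or> lt a x}"

lemma increasing_sequence_less:
  assumes lin: "lin_on X lt" and s: "\<And>n. s n \<in> X" "\<And>n. lt (s n) (s (Suc n))" and "m < n"
  shows "lt (s m) (s n)"
  using \<open>m < n\<close>
proof (induction n)
  case (Suc n)
  then show ?case using s(2)[of n] lin_on_trans[OF lin _ s(2)[of n] s(1) s(1) s(1)] by (auto simp: less_Suc_eq)
qed simp

lemma ico_sequence_Union:
  assumes lin: "lin_on X lt" and s: "\<And>n. s n \<in> X" "\<And>n. lt (s n) (s (Suc n))"
  shows "(\<Union>n. ico lt X (s n) (s (Suc n))) = from_on lt X (s 0) \<inter> (\<Union>n. before lt X (s n))"
proof
  have "lt (s 0) x \<or> x = s 0" if x: "x \<in> X" "x = s n \<or> lt (s n) x" for x n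
  proof (cases n)
    case 0
    then show ?thesis using x by blast
  next
    case (Suc m)
    then have "lt (s 0) (s n)" using increasing_sequence_less[where s = s, OF lin s, of 0 n] by simp
    then show ?thesis using x lin_on_trans[OF lin _ _ s(1) s(1) x(1), of 0 n] by blast
  qed
  then show "(\<Union>n. ico lt X (s n) (s (Suc n))) \<subseteq> from_on lt X (s 0) \<inter> (\<Union>n. before lt X (s n))"
    unfolding ico_def from_on_def before_def by blast
next
  show "from_on lt X (s 0) \<inter> (\<Union>n. before lt X (s n)) \<subseteq> (\<Union>n. ico lt X (s n) (s (Suc n)))"
  proof
    fix x assume "x \<in> from_on lt X (s 0) \<inter> (\<Union>n. before lt X (s n))"
    then obtain n where x: "x \<in> X" "x = s 0 \<or> lt (s 0) x" and n: "lt x (s n)"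
      unfolding from_on_def before_def by blast
    \<comment> \<open>The index of the first term above \<open>x\<close> is a successor, because
      \<open>x\<close> is not below \<open>s 0\<close>; the preceding term starts the piece that
      contains \<open>x\<close>.\<close>
    define m where "m = (LEAST n. lt x (s n))"
    have m: "lt x (s m)" unfolding m_def using n by (rule LeastI)
    have "\<not> lt x (s 0)" using x lin_on_irrefl[OF lin s(1)] lin_on_asym[OF lin _ s(1) x(1)] by blast
    then obtain k where k: "m = Suc k" using m by (cases m) auto
    have "\<not> lt x (s k)" using not_less_Least[of k "\<lambda>n. lt x (s n)"] k unfolding m_def by simp
    then have "x = s k \<or> lt (s k) x" using lin_on_total[OF lin x(1) s(1)[of k]] by blast
    then have "x \<in> ico lt X (s k) (s (Suc k))" using x(1) m k unfolding ico_def by blast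
    then show "x \<in> (\<Union>n. ico lt X (s n) (s (Suc n)))" by blast
  qed
qed

lemma lin_on_less_nat: "lin_on A ((<) :: nat \<Rightarrow> nat \<Rightarrow> bool)"
  unfolding lin_on_def by auto

lemma ordered_family_ico:
  assumes lin: "lin_on X lt" and s: "\<And>n. s n \<in> X" "\<And>n. lt (s n) (s (Suc n))"
  shows "ordered_family (<) lt UNIV (\<lambda>n::nat. ico lt X (s n) (s (Suc n)))"
proof -
  have "precedes lt (ico lt X (s m) (s (Suc m))) (ico lt X (s n) (s (Suc n)))" if "m < n" for m n
    unfolding precedes_def
  proof (intro ballI)
    fix x y assume x: "x \<in> ico lt X (s m) (s (Suc m))" and y: "y \<in> ico lt X (s n) (s (Suc n))"
    have X: "x \<in> X" "y \<in> X" and xl: "lt x (s (Suc m))" and yl: "y = s n \<or> lt (s n) y"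
      using x y unfolding ico_def by auto
    have "Suc m = n \<or> lt (s (Suc m)) (s n)"
      using increasing_sequence_less[where s = s, OF lin s, of "Suc m" n] that by (cases "Suc m = n") auto
    then have "lt x (s n)" using xl lin_on_trans[OF lin xl _ X(1) s(1) s(1)] by blast
    then show "lt x y" using yl lin_on_trans[OF lin _ _ X(1) s(1) X(2)] by blast
  qed
  moreover have "lin_on (\<Union>n. ico lt X (s n) (s (Suc n))) lt"
    by (rule lin_on_subset[OF lin]) (auto simp: ico_def)
  ultimately show ?thesis unfolding ordered_family_def using lin_on_less_nat by blast
qed

section \<open>Lexicographic products and absorption of multiples\<close>

definition lex_less :: "('i \<Rightarrow> 'i \<Rightarrow> bool) \<Rightarrow> ('a \<Rightarrow> 'a \<Rightarrow> bool) \<Rightarrow> 'i \<times> 'a \<Rightarrow> 'i \<times> 'a \<Rightarrow> bool" where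
  "lex_less li lt p p' \<longleftrightarrow> li (fst p) (fst p') \<or> fst p = fst p' \<and> lt (snd p) (snd p')"

lemma lin_on_lex_less:
  assumes "lin_on I li" "lin_on X lt"
  shows "lin_on (I \<times> X) (lex_less li lt)"
  unfolding lin_on_def
proof (intro conjI ballI impI)
  fix p assume "p \<in> I \<times> X"
  then show "\<not> lex_less li lt p p"
    using lin_on_irrefl[OF assms(1)] lin_on_irrefl[OF assms(2)] unfolding lex_less_def by auto
next
  fix p p' p'' assume "p \<in> I \<times> X" "p' \<in> I \<times> X" "p'' \<in> I \<times> X"
    "lex_less li lt p p'" "lex_less li lt p' p''"
  then show "lex_less li lt p p''"
    using lin_on_trans[OF assms(1), of "fst p" "fst p'" "fst p''"]
      lin_on_trans[OF assms(2), of "snd p" "snd p'" "snd p''"] unfolding lex_less_def by auto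
next
  fix p p' assume "p \<in> I \<times> X" "p' \<in> I \<times> X"
  then show "p = p' \<or> lex_less li lt p p' \<or> lex_less li lt p' p"
    using lin_on_total[OF assms(1), of "fst p" "fst p'"] lin_on_total[OF assms(2), of "snd p" "snd p'"]
    unfolding lex_less_def by (auto simp: prod_eq_iff)
qed

lemma ordered_family_lex:
  assumes "lin_on I li" "lin_on X lt" "ordered_family lj li J F" "\<And>j. j \<in> J \<Longrightarrow> F j \<subseteq> I"
  shows "ordered_family lj (lex_less li lt) J (\<lambda>j. F j \<times> X)"
proof -
  have "lin_on (\<Union>j\<in>J. F j \<times> X) (lex_less li lt)"
    by (rule lin_on_subset[OF lin_on_lex_less[OF assms(1,2)]]) (use assms(4) in auto)
  then show ?thesis
    using assms(3) unfolding ordered_family_def precedes_def lex_less_def by auto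
qed

lemma ordered_family_singletons: "lin_on I li \<Longrightarrow> ordered_family li li I (\<lambda>i. {i})"
  unfolding ordered_family_def precedes_def by auto

lemma UN_Times_singleton: "(\<Union>i\<in>I. {i} \<times> X) = I \<times> X"
  by auto

lemma ef_singleton_Times:
  assumes "\<And>x. x \<in> X \<Longrightarrow> M (i, x) x" and "\<not> li i i"
  shows "ef (lex_less li lt) lt M n ({i} \<times> X) X"
  by (rule ef_iso[of snd]) (use assms in \<open>auto simp: lex_less_def\<close>)

text \<open>The products are sums of copies of \<open>X\<close> and \<open>Y\<close>. All blocks are
  equivalent, so the index orders need only be equivalent without colours.\<close>

lemma ef_Times_index:
  assumes "ef li lj (\<lambda>_ _. True) n I J" and "lin_on I li" "lin_on J lj" "lin_on X lt" "lin_on Y lt'"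
    and "ef lt lt' (\<lambda>x y. c x = c' y) n X Y"
  shows "ef (lex_less li lt) (lex_less lj lt') (\<lambda>p p'. c (snd p) = c' (snd p')) n (I \<times> X) (J \<times> Y)"
proof -
  let ?M = "\<lambda>p p'. c (snd p) = c' (snd p')"
  have "ef (lex_less li lt) (lex_less lj lt') ?M n (\<Union>i\<in>I. {i} \<times> X) (\<Union>j\<in>J. {j} \<times> Y)"
  proof (rule ef_sum)
    show "ordered_family li (lex_less li lt) I (\<lambda>i. {i} \<times> X)"
      by (rule ordered_family_lex[OF assms(2,4) ordered_family_singletons[OF assms(2)]]) simp
    show "ordered_family lj (lex_less lj lt') J (\<lambda>j. {j} \<times> Y)"
      by (rule ordered_family_lex[OF assms(3,5) ordered_family_singletons[OF assms(3)]]) simp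
    show "ef li lj (\<lambda>i j. ef (lex_less li lt) (lex_less lj lt') ?M n ({i} \<times> X) ({j} \<times> Y)) n I J"
    proof (rule ef_mono_match[OF assms(1)])
      fix i j assume ij: "i \<in> I" "j \<in> J"
      have "ef (lex_less li lt) lt (\<lambda>p x. c (snd p) = c x) n ({i} \<times> X) X"
        by (rule ef_singleton_Times) (use lin_on_irrefl[OF assms(2) ij(1)] in auto)
      then have "ef (lex_less li lt) lt' (\<lambda>p y. c (snd p) = c' y) n ({i} \<times> X) Y"
        by (rule ef_trans[OF _ assms(6)]) simp
      moreover have "ef (lex_less lj lt') lt' (\<lambda>p x. c' (snd p) = c' x) n ({j} \<times> Y) Y"
        by (rule ef_singleton_Times) (use lin_on_irrefl[OF assms(3) ij(2)] in auto)
      from ef_sym[OF this] have "ef lt' (lex_less lj lt') (\<lambda>x p. c' (snd p) = c' x) n Y ({j} \<times> Y)" .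
      ultimately show "ef (lex_less li lt) (lex_less lj lt') ?M n ({i} \<times> X) ({j} \<times> Y)"
        by (rule ef_trans) simp
    qed
  qed
  then show ?thesis unfolding UN_Times_singleton .
qed

text \<open>Since the index is the major coordinate, \<open>I \<times> X\<close> consists of
  \<open>I\<close> many copies of \<open>X\<close>; in the notation of the overview this says that X
  \<cdot> I \<equiv> X at rank \<open>n\<close>.\<close>

definition absorbs :: "('i \<Rightarrow> 'i \<Rightarrow> bool) \<Rightarrow> ('a \<Rightarrow> 'a \<Rightarrow> bool) \<Rightarrow> ('a \<Rightarrow> nat) \<Rightarrow> nat \<Rightarrow> 'i set \<Rightarrow> 'a set \<Rightarrow> bool"
  where "absorbs li lt c n I X \<longleftrightarrow> ef (lex_less li lt) lt (\<lambda>p x. c (snd p) = c x) n (I \<times> X) X"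

lemma absorbs_singleton: "\<not> li i i \<Longrightarrow> absorbs li lt c n {i} X"
  unfolding absorbs_def by (rule ef_singleton_Times) auto

text \<open>The argument rests on 1 + \<omega> = \<omega>. The part over \<open>I\<close> is
  equivalent to the first copy of \<open>X\<close> in X \<cdot> \<omega>, and the part over
  \<open>J\<close> to all the other copies, because these again form X \<cdot> \<omega>.\<close>

lemma absorbs_concat:
  assumes X: "lin_on X lt" and omega: "absorbs ((<) :: nat \<Rightarrow> _) lt c n UNIV X"
    and I: "lin_on (I \<union> J) li" "precedes li I J"
    and abs: "absorbs li lt c n I X" "absorbs li lt c n J X"
  shows "absorbs li lt c n (I \<union> J) X"
proof -
  let ?l = "lex_less ((<) :: nat \<Rightarrow> _) lt" and ?P = "{Suc 0..} \<times> X"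
  have l: "lin_on (U \<times> X) ?l" for U by (rule lin_on_lex_less[OF lin_on_less_nat X])
  have "ef lt ?l (\<lambda>x p. c (snd p) = c x) n X ({0} \<times> X)"
    by (rule ef_sym[OF ef_singleton_Times[of _ "\<lambda>p x. c (snd p) = c x"]]) auto
  then have 1: "ef (lex_less li lt) ?l (\<lambda>p p'. c (snd p) = c (snd p')) n (I \<times> X) ({0} \<times> X)"
    by (rule ef_trans[OF abs(1)[unfolded absorbs_def]]) simp
  have "ef ?l ?l (\<lambda>p p'. c (snd p) = c (snd p')) n (UNIV \<times> X) ?P"
  proof (rule ef_iso[of "\<lambda>(k, x). (Suc k, x)"])
    have "(k, x) \<in> (\<lambda>(k, x). (Suc k, x)) ` (UNIV \<times> X)" if "Suc 0 \<le> k" "x \<in> X" for k x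
      using that by (intro image_eqI[of _ _ "(k - 1, x)"]) auto
    then show "(\<lambda>(k, x). (Suc k, x)) ` (UNIV \<times> X) = ?P" by auto
  qed (auto simp: lex_less_def)
  with ef_sym[OF omega[unfolded absorbs_def]]
  have "ef lt ?l (\<lambda>x p. c (snd p) = c x) n X ?P" by (rule ef_trans) simp
  then have 2: "ef (lex_less li lt) ?l (\<lambda>p p'. c (snd p) = c (snd p')) n (J \<times> X) ?P"
    by (rule ef_trans[OF abs(2)[unfolded absorbs_def]]) simp
  have "ef (lex_less li lt) ?l (\<lambda>p p'. c (snd p) = c (snd p')) n (I \<times> X \<union> J \<times> X) ({0} \<times> X \<union> ?P)"
  proof (rule ef_concat[OF 1 2])
    show "lin_on (I \<times> X \<union> J \<times> X) (lex_less li lt)"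
      using lin_on_lex_less[OF I(1) X] by (simp add: Sigma_Un_distrib1)
    show "lin_on ({0} \<times> X \<union> ?P) ?l" using l[of "{0} \<union> {Suc 0..}"] by (simp only: Sigma_Un_distrib1)
  qed (use I(2) in \<open>auto simp: precedes_def lex_less_def\<close>)
  moreover have "I \<times> X \<union> J \<times> X = (I \<union> J) \<times> X" "{0} \<times> X \<union> ?P = UNIV \<times> X"
    by (auto simp: Suc_le_eq)
  ultimately have "ef (lex_less li lt) ?l (\<lambda>p p'. c (snd p) = c (snd p')) n ((I \<union> J) \<times> X) (UNIV \<times> X)"
    by simp
  then show ?thesis unfolding absorbs_def
    by (rule ef_trans[OF _ omega[unfolded absorbs_def]]) simp
qed

text \<open>Each part over \<open>F k\<close> collapses to a single copy of \<open>X\<close>, which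
  leaves X \<cdot> \<omega>.\<close>

lemma absorbs_Union:
  fixes F :: "nat \<Rightarrow> 'i set"
  assumes X: "lin_on X lt" and omega: "absorbs ((<) :: nat \<Rightarrow> _) lt c n UNIV X"
    and I: "lin_on I li" "ordered_family (<) li UNIV F" "I = (\<Union>k. F k)"
    and abs: "\<And>k. absorbs li lt c n (F k) X"
  shows "absorbs li lt c n I X"
proof -
  let ?l = "lex_less ((<) :: nat \<Rightarrow> _) lt" and ?M = "\<lambda>p p'. c (snd p) = c (snd p')"
  have "ef (lex_less li lt) ?l ?M n (\<Union>k. F k \<times> X) (\<Union>k. {k} \<times> X)"
  proof (rule ef_sum)
    show "ef (<) (<) (\<lambda>i j. ef (lex_less li lt) ?l ?M n (F i \<times> X) ({j} \<times> X)) n UNIV UNIV"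
    proof (rule ef_refl)
      fix k :: nat
      have "ef lt ?l (\<lambda>x p. c (snd p) = c x) n X ({k} \<times> X)"
        by (rule ef_sym[OF ef_singleton_Times[of _ "\<lambda>p x. c (snd p) = c x"]]) auto
      then show "ef (lex_less li lt) ?l ?M n (F k \<times> X) ({k} \<times> X)"
        by (rule ef_trans[OF abs[unfolded absorbs_def]]) simp
    qed
    show "ordered_family (<) (lex_less li lt) UNIV (\<lambda>k. F k \<times> X)"
      by (rule ordered_family_lex[OF I(1) X I(2)]) (use I(3) in blast)
    show "ordered_family (<) ?l UNIV (\<lambda>k. {k} \<times> X)"
      by (rule ordered_family_lex[OF lin_on_less_nat[of UNIV] X ordered_family_singletons[OF lin_on_less_nat]]) simp
  qed
  moreover have "(\<Union>k. F k \<times> X) = I \<times> X" "(\<Union>k::nat. {k} \<times> X) = UNIV \<times> X" using I(3) by auto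
  ultimately have "ef (lex_less li lt) ?l ?M n (I \<times> X) (UNIV \<times> X)" by simp
  then show ?thesis unfolding absorbs_def
    by (rule ef_trans[OF _ omega[unfolded absorbs_def]]) simp
qed

text \<open>A countable well-order either has a largest element, and is an interval followed by a
  point, or has cofinality omega, and is an omega-sum of half-open intervals. Either way absorption
  is inherited from intervals.\<close>

lemma absorbs_step:
  assumes X: "lin_on X lt" and omega: "absorbs ((<) :: nat \<Rightarrow> _) lt c n UNIV X"
    and S: "lin_on S li" "wfp li" "countable S" "S \<noteq> {}"
    and abs: "\<And>a b. a \<in> S \<Longrightarrow> b \<in> S \<Longrightarrow> li a b \<Longrightarrow> absorbs li lt c n (ico li S a b) X"
  shows "absorbs li lt c n S X"
proof -
  obtain a0 where "a0 \<in> S" and min: "\<And>y. li y a0 \<Longrightarrow> y \<notin> S"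
    using S(4) by (metis all_not_in_conv wfE_min[OF S(2)[unfolded wfp_def]] case_prodI mem_Collect_eq)
  then have a0: "a0 \<in> S" "\<And>x. x \<in> S \<Longrightarrow> x = a0 \<or> li a0 x"
    using lin_on_total[OF S(1)] by blast+
  show ?thesis
  proof (cases "\<exists>m\<in>S. \<forall>x\<in>S. \<not> li m x")
    case True
    then obtain m where m: "m \<in> S" "\<And>x. x \<in> S \<Longrightarrow> x = m \<or> li x m"
      using lin_on_total[OF S(1)] by blast
    have m': "absorbs li lt c n {m} X" using absorbs_singleton lin_on_irrefl[OF S(1) m(1)] by fast
    show ?thesis
    \<comment> \<open>If \<open>a0 = m\<close>, the interval below \<open>m\<close> is empty and
      \<open>abs\<close> does not apply to it.\<close>
    proof (cases "a0 = m")
      case True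
      then have "S = {m}" using a0(2) m min by blast
      then show ?thesis using m' by simp
    next
      case False
      then have "li a0 m" using m a0(1) by blast
      moreover have S_eq: "S = ico li S a0 m \<union> {m}" unfolding ico_def using a0(2) m by blast
      ultimately have "absorbs li lt c n (ico li S a0 m \<union> {m}) X"
        using absorbs_concat[OF X omega _ _ abs[OF a0(1) m(1)] m'] S(1)
        by (auto simp: precedes_def ico_def)
      then show ?thesis using S_eq by simp
    qed
  next
    case False
    \<comment> \<open>Without a largest element, an increasing sequence that passes above every
      enumerated \<open>e k\<close> is cofinal in \<open>S\<close>.\<close>
    define e where "e = from_nat_into S"
    have e: "e k \<in> S" for k unfolding e_def using S(4) by (rule from_nat_into)
    have "\<exists>y\<in>S. li x y \<and> li (e k) y" if x: "x \<in> S" for x k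
    proof -
      obtain y where "y \<in> S" "li x y" using False x by blast
      moreover obtain y' where "y' \<in> S" "li (e k) y'" using False e by blast
      ultimately show ?thesis
        using lin_on_total[OF S(1), of y y'] lin_on_trans[OF S(1) \<open>li x y\<close> _ x, of y']
          lin_on_trans[OF S(1) \<open>li (e k) y'\<close> _ e, of y] by blast
    qed
    then have "\<forall>k. \<forall>x. \<exists>y. x \<in> S \<longrightarrow> y \<in> S \<and> li x y \<and> li (e k) y" by blast
    then obtain g where g: "\<And>k x. x \<in> S \<Longrightarrow> g k x \<in> S \<and> li x (g k x) \<and> li (e k) (g k x)" by metis
    define s where "s = rec_nat a0 g"
    have sS: "s k \<in> S" for k by (induction k) (use a0 g in \<open>auto simp: s_def\<close>)
    have s: "li (s k) (s (Suc k))" "li (e k) (s (Suc k))" for k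
      using g[OF sS[of k], of k] by (auto simp: s_def)
    have "(\<Union>k. before li S (s k)) = S"
    proof
      show "S \<subseteq> (\<Union>k. before li S (s k))"
      proof
        fix x assume "x \<in> S"
        moreover obtain k where "x = e k"
          using from_nat_into_surj[OF S(3) \<open>x \<in> S\<close>] unfolding e_def by metis
        ultimately show "x \<in> (\<Union>k. before li S (s k))" using s(2) unfolding before_def by blast
      qed
    qed (auto simp: before_def)
    moreover have "from_on li S (s 0) = S" using a0 unfolding from_on_def s_def by auto
    ultimately have S_eq: "S = (\<Union>k. ico li S (s k) (s (Suc k)))"
      using ico_sequence_Union[where s = s, OF S(1) sS s(1)] by simp
    show ?thesis
      by (rule absorbs_Union[OF X omega S(1) ordered_family_ico[where s = s, OF S(1) sS s(1)] S_eq])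
        (rule abs[OF sS sS s(1)])
  qed
qed

text \<open>Intervals are treated first, by well-founded induction on the right endpoint; a last
  application of \<open>absorbs_step\<close> passes from intervals to all of
  \<open>N\<close>.\<close>

lemma absorbs_countable:
  assumes X: "lin_on X lt" and omega: "absorbs ((<) :: nat \<Rightarrow> _) lt c n UNIV X"
    and N: "lin_on N li" "wfp li" "countable N" "N \<noteq> {}"
  shows "absorbs li lt c n N X"
proof -
  have "a \<in> N \<Longrightarrow> b \<in> N \<Longrightarrow> li a b \<Longrightarrow> absorbs li lt c n (ico li N a b) X" for a b
    using N(2)
  proof (induction b arbitrary: a rule: wfp_induct_rule)
    case (less b)
    let ?S = "ico li N a b"
    have sub: "?S \<subseteq> N" unfolding ico_def by blast
    show ?case
    proof (rule absorbs_step[OF X omega lin_on_subset[OF N(1) sub] N(2) countable_subset[OF sub N(3)]])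
      show "?S \<noteq> {}" using less.prems unfolding ico_def by blast
      fix a' b' assume a': "a' \<in> ?S" and b': "b' \<in> ?S" and "li a' b'"
      have N': "a' \<in> N" "b' \<in> N" "li b' b" "a' = a \<or> li a a'" using a' b' unfolding ico_def by auto
      \<comment> \<open>An interval computed inside \<open>?S\<close> is an interval of
        \<open>N\<close> whose right endpoint lies below \<open>b\<close>, so the induction
        hypothesis applies.\<close>
      have "ico li ?S a' b' = ico li N a' b'"
        using N' lin_on_trans[OF N(1) _ _ less.prems(1) N'(1)]
          lin_on_trans[OF N(1) _ N'(3) _ N'(2) less.prems(2)] unfolding ico_def by blast
      then show "absorbs li lt c n (ico li ?S a' b') X"
        using less.IH[OF N'(3,1,2) \<open>li a' b'\<close>] by simp
    qed
  qed
  then show ?thesis by (rule absorbs_step[OF X omega N])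
qed

section \<open>Tails of closed segments and the absorbing tail\<close>

lemma elementary_ef:
  assumes lin: "lin_on X lt" and Z: "Z \<subseteq> X" "elementary lt c Z X"
  shows elementary_whole: "ef lt lt (\<lambda>x y. c x = c y) n Z X"
    and elementary_before: "s \<in> Z \<Longrightarrow> ef lt lt (\<lambda>x y. c x = c y) n (before lt Z s) (before lt X s)"
    and elementary_from: "s \<in> Z \<Longrightarrow> ef lt lt (\<lambda>x y. c x = c y) n (from_on lt Z s) (from_on lt X s)"
proof -
  let ?M = "\<lambda>x y. c x = c y"
  have el: "ef lt lt ?M n (gap lt Z (set_option a) (set_option b)) (gap lt X (set_option a) (set_option b))"
    if "a \<in> opts Z" "b \<in> opts Z" for a b
    using Z(2) that unfolding elementary_def by blast
  have N: "None \<in> opts Z" unfolding opts_def by blast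
  show "ef lt lt ?M n Z X" using el[OF N N] by (simp add: gap_def)
  assume s: "s \<in> Z"
  then have S: "Some s \<in> opts Z" unfolding opts_def by blast
  show "ef lt lt ?M n (before lt Z s) (before lt X s)"
    using el[OF N S] by (simp add: gap_def before_def)
  have af: "ef lt lt ?M n (after lt Z s) (after lt X s)"
    using el[OF S N] by (simp add: gap_def after_def)
  \<comment> \<open>Gaps are open at their bounds, so \<open>s\<close> itself is put back in
    front.\<close>
  have "ef lt lt ?M n ({s} \<union> after lt Z s) ({s} \<union> after lt X s)"
  proof (rule ef_concat[OF ef_refl af])
    show "lin_on ({s} \<union> after lt Z s) lt" "lin_on ({s} \<union> after lt X s) lt"
      by (rule lin_on_subset[OF lin], use s Z(1) in \<open>auto simp: after_def\<close>)+
  qed (auto simp: precedes_def after_def)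
  moreover have "{s} \<union> after lt Z s = from_on lt Z s" "{s} \<union> after lt X s = from_on lt X s"
    using s Z(1) unfolding from_on_def after_def by auto
  ultimately show "ef lt lt ?M n (from_on lt Z s) (from_on lt X s)" by simp
qed

text \<open>One segment, from \<open>s 0\<close> up to the limit, is read in two ways: as a tail of
  a closed segment it is equivalent to the full tail, and as an omega-sum of pieces it is equivalent
  to omega copies of that tail.\<close>

lemma absorbing_tail:
  assumes r: "Card_order r" "regularCard r" "natLeq <o r"
    and c: "\<And>x. x \<in> Field r \<Longrightarrow> c x < (d::nat)"
    and H: "range H \<subseteq> Field r"
    and el: "\<And>Z. Z \<subseteq> Field r \<Longrightarrow> skolem_image H Z \<subseteq> Z \<Longrightarrow> elementary (strict r) c Z (Field r)"
  obtains s where "s \<in> Field r" "absorbs ((<) :: nat \<Rightarrow> _) (strict r) c n UNIV (from_on (strict r) (Field r) s)"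
proof -
  let ?lt = "strict r" and ?X = "Field r" and ?M = "\<lambda>x y. c x = c y"
  let ?B = "before ?lt ?X" and ?T = "from_on ?lt ?X"
  have wo: "Well_order r" using r(1) unfolding card_order_on_def by blast
  note lin = lin_on_strict[OF wo]
  have "?X \<noteq> {}" using H by blast
  then obtain a where a: "a \<in> ?X" by blast
  have "\<exists>y. ?lt x y \<and> skolem_image H (?B y) \<subseteq> ?B y" if "x \<in> ?X" for x
    by (rule closed_segment_above[OF r H that]) blast
  then have "\<exists>g. \<forall>x. x \<in> ?X \<longrightarrow> ?lt x (g x) \<and> skolem_image H (?B (g x)) \<subseteq> ?B (g x)"
    by (intro choice) blast
  then obtain g where g: "\<And>x. x \<in> ?X \<Longrightarrow> ?lt x (g x)"
    "\<And>x. x \<in> ?X \<Longrightarrow> skolem_image H (?B (g x)) \<subseteq> ?B (g x)" by blast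
  have gX: "g x \<in> ?X" if "x \<in> ?X" for x using strict_Field[OF g(1)[OF that]] by simp
  \<comment> \<open>With \<open>Suc k\<close> even \<open>t 0\<close> is a value of
    \<open>g\<close>, so the segment below it is closed; nothing is known about the segment below
    \<open>a\<close>.\<close>
  define t where "t k = (g ^^ Suc k) a" for k
  have gk: "(g ^^ k) a \<in> ?X" for k by (induction k) (simp_all add: a gX)
  have t: "t k \<in> ?X" "?lt (t k) (t (Suc k))" "skolem_image H (?B (t k)) \<subseteq> ?B (t k)" for k
    using gk[of "Suc k"] g(1)[OF gk[of "Suc k"]] g(2)[OF gk[of k]] unfolding t_def by simp_all
  obtain f :: "'a set \<Rightarrow> nat" and N where "(\<forall>U\<subseteq>?X. f U < N) \<and>
      (\<forall>U V. U \<subseteq> ?X \<longrightarrow> V \<subseteq> ?X \<longrightarrow> f U = f V \<longrightarrow> ef ?lt ?lt ?M n U V)"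
    using ef_finite_types[where X = ?X and c = c and d = d and n = n and lt = ?lt] c by auto
  then have fN: "\<And>U. U \<subseteq> ?X \<Longrightarrow> f U < N"
    and f: "\<And>U V. U \<subseteq> ?X \<Longrightarrow> V \<subseteq> ?X \<Longrightarrow> f U = f V \<Longrightarrow> ef ?lt ?lt ?M n U V" by simp_all
  have TX: "?T x \<subseteq> ?X" for x unfolding from_on_def by blast
  \<comment> \<open>Finitely many types of tails: the pigeonhole principle yields a subsequence
    along which the type is constant.\<close>
  have "finite (range (\<lambda>k. f (?T (t k))))"
    by (rule finite_subset[of _ "{..<N}"]) (use fN TX in auto)
  then obtain k0 where "infinite {k \<in> UNIV. f (?T (t k)) = f (?T (t k0))}"
    using pigeonhole_infinite[of UNIV "\<lambda>k. f (?T (t k))"] by auto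
  then obtain h :: "nat \<Rightarrow> nat" where h: "strict_mono h" "\<And>k. f (?T (t (h k))) = f (?T (t k0))"
    using infinite_enumerate[of "{k. f (?T (t k)) = f (?T (t k0))}"] by auto
  define s where "s k = t (h k)" for k
  have sX: "s k \<in> ?X" and s_closed: "skolem_image H (?B (s k)) \<subseteq> ?B (s k)" for k
    unfolding s_def by (rule t)+
  have s_less: "?lt (s k) (s (Suc k))" for k
    using increasing_sequence_less[where s = t, OF lin t(1,2)] strict_monoD[OF h(1), of k "Suc k"]
    unfolding s_def by simp
  have sT: "ef ?lt ?lt ?M n (?T (s j)) (?T (s k))" for j k
    by (rule f[OF TX TX]) (simp add: s_def h(2))
  obtain \<delta> where \<delta>: "\<delta> \<in> ?X" "\<And>k. ?lt (s k) \<delta>" "?B \<delta> = (\<Union>k. ?B (s k))"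
    by (rule increasing_sequence_limit[OF r, of s]) (auto intro: s_less)
  have B_mono: "?B (s k) \<subseteq> ?B (s (Suc k))" for k
    unfolding before_def using lin_on_trans[OF lin _ s_less _ sX sX] by blast
  have "skolem_image H (?B \<delta>) \<subseteq> ?B \<delta>"
    unfolding \<delta>(3)
  proof (rule skolem_image_chain)
    show "skolem_image H (?B (s k)) \<subseteq> ?B (s (Suc k))" for k
      using s_closed[of k] B_mono[of k] by simp
  qed (rule B_mono)
  then have el\<delta>: "elementary ?lt c (?B \<delta>) ?X" by (intro el before_subset)
  let ?P = "\<lambda>k. ico ?lt ?X (s k) (s (Suc k))"
  have P: "ef ?lt ?lt ?M n (?P k) (?T (s 0))" for k
  proof -
    \<comment> \<open>The piece is the tail from \<open>s k\<close> of the closed segment below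
      \<open>s (Suc k)\<close>, hence equivalent to the full tail from \<open>s k\<close>, and by
      constancy of types to the one from \<open>s 0\<close>.\<close>
    have "s k \<in> ?B (s (Suc k))" using sX s_less unfolding before_def by blast
    from elementary_from[OF lin before_subset el[OF before_subset s_closed] this]
    have "ef ?lt ?lt ?M n (from_on ?lt (?B (s (Suc k))) (s k)) (?T (s k))" .
    moreover have "from_on ?lt (?B (s (Suc k))) (s k) = ?P k"
      unfolding from_on_def before_def ico_def by blast
    ultimately have "ef ?lt ?lt ?M n (?P k) (?T (s k))" by simp
    then show ?thesis by (rule ef_trans[OF _ sT]) simp
  qed
  have UP: "(\<Union>k. ?P k) = from_on ?lt (?B \<delta>) (s 0)"
    unfolding ico_sequence_Union[where s = s, OF lin sX s_less] \<delta>(3)[symmetric]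
    unfolding from_on_def before_def by blast
  have tail: "ef ?lt ?lt ?M n (\<Union>k. ?P k) (?T (s 0))"
    unfolding UP
    by (rule elementary_from[OF lin before_subset el\<delta>]) (use sX \<delta>(2) in \<open>auto simp: before_def\<close>)
  let ?l = "lex_less ((<) :: nat \<Rightarrow> _) ?lt"
  have linT: "lin_on (?T (s 0)) ?lt" by (rule lin_on_subset[OF lin TX])
  have "ef ?lt ?l (\<lambda>x p. c x = c (snd p)) n (\<Union>k. ?P k) (\<Union>k. {k} \<times> ?T (s 0))"
  proof (rule ef_sum)
    show "ef (<) (<) (\<lambda>j k. ef ?lt ?l (\<lambda>x p. c x = c (snd p)) n (?P j) ({k} \<times> ?T (s 0))) n UNIV UNIV"
    proof (rule ef_refl)
      fix k :: nat
      have "ef ?lt ?l (\<lambda>x p. c (snd p) = c x) n (?T (s 0)) ({k} \<times> ?T (s 0))"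
        by (rule ef_sym[OF ef_singleton_Times[of _ "\<lambda>p x. c (snd p) = c x"]]) auto
      then show "ef ?lt ?l (\<lambda>x p. c x = c (snd p)) n (?P k) ({k} \<times> ?T (s 0))"
        by (rule ef_trans[OF P]) simp
    qed
    show "ordered_family (<) ?lt UNIV ?P"
      by (rule ordered_family_ico[where s = s, OF lin sX s_less])
    show "ordered_family (<) ?l UNIV (\<lambda>k. {k} \<times> ?T (s 0))"
      by (rule ordered_family_lex[OF lin_on_less_nat[of UNIV] linT
            ordered_family_singletons[OF lin_on_less_nat]]) simp
  qed
  then have "ef ?lt ?l (\<lambda>x p. c x = c (snd p)) n (\<Union>k. ?P k) (UNIV \<times> ?T (s 0))"
    unfolding UN_Times_singleton .
  from ef_sym[OF this] have "ef ?l ?lt (\<lambda>p x. c (snd p) = c x) n (UNIV \<times> ?T (s 0)) (?T (s 0))"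
    by (rule ef_trans[OF _ tail]) simp
  then show ?thesis using that[OF sX] unfolding absorbs_def by blast
qed

section \<open>Well-orders of cardinal order type and uncountable multiples\<close>

definition rel_on :: "'a set \<Rightarrow> ('a \<Rightarrow> 'a \<Rightarrow> bool) \<Rightarrow> 'a rel" where
  "rel_on V lt = {(x, y). x \<in> V \<and> y \<in> V \<and> (x = y \<or> lt x y)}"

lemma Field_rel_on: "Field (rel_on V lt) = V"
  unfolding rel_on_def Field_def by auto

lemma strict_rel_on:
  "lin_on V lt \<Longrightarrow> strict (rel_on V lt) x y \<longleftrightarrow> x \<in> V \<and> y \<in> V \<and> lt x y"
  unfolding strict_def rel_on_def using lin_on_irrefl by fastforce

lemma Well_order_rel_on:
  assumes V: "lin_on V lt" and wf: "wfp lt"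
  shows "Well_order (rel_on V lt)"
proof -
  have "refl_on V (rel_on V lt)" "antisym (rel_on V lt)" "total_on V (rel_on V lt)"
    "rel_on V lt \<subseteq> V \<times> V"
    using lin_on_asym[OF V] lin_on_total[OF V]
    unfolding rel_on_def refl_on_def antisym_def total_on_def by blast+
  moreover have "trans (rel_on V lt)"
    using lin_on_trans[OF V] unfolding rel_on_def trans_def by blast
  moreover have "wf (rel_on V lt - Id)"
    using wf[unfolded wfp_def] by (rule wf_subset) (auto simp: rel_on_def)
  ultimately show ?thesis
    unfolding well_order_on_def linear_order_on_def partial_order_on_def preorder_on_def Field_rel_on
    by simp
qed

text \<open>The size of \<open>W\<close> gives \<open>r \<le>o W\<close>. Were \<open>r\<close>
  shorter, it would be isomorphic to a proper initial segment of \<open>W\<close>, and these are too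
  small.\<close>

lemma ordIso_Card_orderI:
  assumes W: "Well_order W" and r: "Card_order r" and ge: "r \<le>o |Field W|"
    and small: "\<And>a. a \<in> Field W \<Longrightarrow> |underS W a| <o r"
  shows "W =o r"
proof -
  have wr: "Well_order r" using r unfolding card_order_on_def by blast
  have "|Field W| \<le>o W" using card_of_least[OF W] .
  then have "r \<le>o W" using ge ordLeq_transitive by blast
  moreover have "\<not> r <o W"
  proof
    assume "r <o W"
    then obtain a where a: "a \<in> Field W" "r =o Restr W (underS W a)"
      using ordLess_iff_ordIso_Restr[OF W wr] by blast
    have "|Field r| =o |Field (Restr W (underS W a))|" using card_of_cong[OF a(2)] .
    moreover have "|Field (Restr W (underS W a))| \<le>o |underS W a|"
      by (rule card_of_mono1) (auto simp: Field_def)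
    ultimately have "|Field r| <o r"
      using small[OF a(1)] ordIso_ordLeq_trans ordLeq_ordLess_trans by blast
    then show False using card_of_Field_ordIso[OF r] not_ordLess_ordIso by blast
  qed
  ultimately show ?thesis
    using ordLeq_iff_ordLess_or_ordIso ordIso_symmetric by blast
qed

lemma wfp_lex_less: "wfp li \<Longrightarrow> wfp lt \<Longrightarrow> wfp (lex_less li lt)"
proof -
  assume "wfp li" "wfp lt"
  then have "wf ({(x, y). li x y} <*lex*> {(x, y). lt x y})" unfolding wfp_def by (rule wf_lex_prod)
  then show "wfp (lex_less li lt)"
    unfolding wfp_def by (rule wf_subset) (auto simp: lex_less_def)
qed

text \<open>The index order is equivalent to a countable suborder, to which the countable case
  applies.\<close>

lemma absorbs_uncountable:
  assumes r: "Card_order r" "natLeq <o r"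
    and X: "lin_on X lt" and omega: "absorbs ((<) :: nat \<Rightarrow> _) lt c n UNIV X"
  shows "absorbs (strict r) lt c n (Field r) X"
proof -
  have wo: "Well_order r" using r(1) unfolding card_order_on_def by blast
  note lin = lin_on_strict[OF wo]
  have "\<not> finite (Field r)"
    using r(2) by (rule infinite_Field_natLeq_less)
  then have ne: "Field r \<noteq> {}" by auto
  then obtain k where k: "k \<in> Field r" by blast
  \<comment> \<open>Index points carry no colours, hence the constant colouring.\<close>
  obtain H where H: "range H \<subseteq> Field r"
    and el: "\<And>Z. Z \<subseteq> Field r \<Longrightarrow> skolem_image H Z \<subseteq> Z \<Longrightarrow> elementary (strict r) (\<lambda>_. 0) Z (Field r)"
    by (rule skolem_functions[OF lin ne, of "\<lambda>_. 0" 1]) auto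
  obtain N where N: "countable N" "{k} \<subseteq> N" "N \<subseteq> Field r" "skolem_image H N \<subseteq> N"
    using countable_skolem_hull[OF H, of "{k}"] k by auto
  have linN: "lin_on N (strict r)" by (rule lin_on_subset[OF lin N(3)])
  have "ef (strict r) (strict r) (\<lambda>_ _. True) n N (Field r)"
    using elementary_whole[OF lin N(3) el[OF N(3,4)], of n] by simp
  from ef_sym[OF this] have "ef (strict r) (strict r) (\<lambda>_ _. True) n (Field r) N" .
  from ef_Times_index[OF this lin linN X X, of c c]
  have 1: "ef (lex_less (strict r) lt) (lex_less (strict r) lt) (\<lambda>p p'. c (snd p) = c (snd p')) n
      (Field r \<times> X) (N \<times> X)"
    by (simp add: ef_refl)
  have "absorbs (strict r) lt c n N X"
    by (rule absorbs_countable[OF X omega linN wfp_strict[OF wo] N(1)]) (use N(2) in blast)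
  then show ?thesis
    unfolding absorbs_def by (rule ef_trans[OF 1]) simp
qed

section \<open>Construction of the coloured ordinal on \<open>\<kappa>\<close>\<close>

theorem theorem12:
  fixes d q :: nat
    and \<kappa> :: "'k rel"
    and \<mu> :: "'l rel"
    and C :: "nat \<Rightarrow> 'l set"
  assumes "d \<ge> 1"
    and "Card_order \<kappa>" "regularCard \<kappa>" "natLeq <o \<kappa>"
    and "Card_order \<mu>" "regularCard \<mu>" "natLeq <o \<mu>"
    and "colored_ordinal d \<mu> C"
  shows "\<exists>D. colored_ordinal d \<kappa> D \<and> fo_equiv d q \<mu> C \<kappa> D"
proof -
  let ?m = "strict \<mu>" and ?k = "strict \<kappa>" and ?X = "Field \<mu>"
  have wo\<mu>: "Well_order \<mu>" and wo\<kappa>: "Well_order \<kappa>"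
    using assms(2,5) unfolding card_order_on_def by auto
  note lin\<mu> = lin_on_strict[OF wo\<mu>] and lin\<kappa> = lin_on_strict[OF wo\<kappa>]
  have ne\<mu>: "?X \<noteq> {}" and ne\<kappa>: "Field \<kappa> \<noteq> {}" using infinite_Field_natLeq_less[OF assms(7)] infinite_Field_natLeq_less[OF assms(4)] by auto

  have cover: "(\<Union>i<d. C i) = ?X" and disj: "disjoint_family_on C {..<d}"
    using assms(8) unfolding colored_ordinal_def by auto
  have "\<forall>x. \<exists>i. x \<in> ?X \<longrightarrow> i < d \<and> x \<in> C i" using cover by blast
  then obtain c where c': "\<And>x. x \<in> ?X \<Longrightarrow> c x < d \<and> x \<in> C (c x)" by metis
  then have c: "\<And>x. x \<in> ?X \<Longrightarrow> c x < d" by blast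
  have cC: "x \<in> C i \<longleftrightarrow> c x = i" if "x \<in> ?X" "i < d" for x i
    using disj c'[OF that(1)] that(2) unfolding disjoint_family_on_def by blast

  obtain H where H: "range H \<subseteq> ?X"
    and el: "\<And>Z. Z \<subseteq> ?X \<Longrightarrow> skolem_image H Z \<subseteq> Z \<Longrightarrow> elementary ?m c Z ?X"
    by (rule skolem_functions[OF lin\<mu> ne\<mu> c]) auto
  obtain s where s: "s \<in> ?X" and abs: "absorbs ((<) :: nat \<Rightarrow> _) ?m c q UNIV (from_on ?m ?X s)"
    by (rule absorbing_tail[OF assms(5-7) c H el, of q])
  \<comment> \<open>The hull contains \<open>s\<close>, so elementarity applies to the parts before
    \<open>s\<close> and from \<open>s\<close> on separately.\<close>
  obtain Z where Z: "countable Z" "{s} \<subseteq> Z" "Z \<subseteq> ?X" "skolem_image H Z \<subseteq> Z"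
    using countable_skolem_hull[OF H, of "{s}"] s by auto
  then have sZ: "s \<in> Z" by blast
  note elZ = el[OF Z(3,4)]
  define L where "L = before ?m Z s"
  define T where "T = from_on ?m Z s"
  have LZ: "L \<subseteq> Z" and TZ: "T \<subseteq> Z" and sT: "s \<in> T"
    using sZ unfolding L_def T_def before_def from_on_def by auto
  have linT: "lin_on T ?m" and lin_tail: "lin_on (from_on ?m ?X s) ?m"
    by (rule lin_on_subset[OF lin\<mu>], use TZ Z(3) in \<open>auto simp: from_on_def\<close>)+
  have eT: "ef ?m ?m (\<lambda>x y. c x = c y) q T (from_on ?m ?X s)"
    unfolding T_def by (rule elementary_from[OF lin\<mu> Z(3) elZ sZ])
  have eL: "ef ?m ?m (\<lambda>x y. c x = c y) q L (before ?m ?X s)"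
    unfolding L_def by (rule elementary_before[OF lin\<mu> Z(3) elZ sZ])

  \<comment> \<open>Absorption of omega passes from the full tail to its countable version
    \<open>T\<close>.\<close>
  have "ef (lex_less (<) ?m) (lex_less (<) ?m) (\<lambda>p p'. c (snd p) = c (snd p')) q
      ((UNIV :: nat set) \<times> T) ((UNIV :: nat set) \<times> from_on ?m ?X s)"
    by (rule ef_Times_index[OF ef_refl lin_on_less_nat lin_on_less_nat linT lin_tail eT]) simp
  then have "ef (lex_less (<) ?m) ?m (\<lambda>p x. c (snd p) = c x) q
      ((UNIV :: nat set) \<times> T) (from_on ?m ?X s)"
    by (rule ef_trans[OF _ abs[unfolded absorbs_def]]) simp
  then have "absorbs ((<) :: nat \<Rightarrow> _) ?m c q UNIV T"
    unfolding absorbs_def by (rule ef_trans[OF _ ef_sym[OF eT]]) simp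
  then have "absorbs ?k ?m c q (Field \<kappa>) T"
    by (rule absorbs_uncountable[OF assms(2,4) linT])
  then have e2: "ef (lex_less ?k ?m) ?m (\<lambda>p x. c (snd p) = c x) q (Field \<kappa> \<times> T) (from_on ?m ?X s)"
    unfolding absorbs_def by (rule ef_trans[OF _ eT]) simp

  \<comment> \<open>The initial part \<open>L\<close> will share the least index \<open>k0\<close>
    with the first copy of \<open>T\<close>, so that a single lexicographic order governs
    everything.\<close>
  obtain k0 where k0: "k0 \<in> Field \<kappa>" and min: "\<And>y. ?k y k0 \<Longrightarrow> y \<notin> Field \<kappa>"
    using ne\<kappa> by (metis all_not_in_conv wfE_min[OF wfp_strict[OF wo\<kappa>, unfolded wfp_def]] case_prodI mem_Collect_eq)
  have k0_least: "k = k0 \<or> ?k k0 k" if "k \<in> Field \<kappa>" for k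
    using lin_on_total[OF lin\<kappa> k0 that] min[of k] that by blast
  have e1: "ef (lex_less ?k ?m) ?m (\<lambda>p x. c (snd p) = c x) q ({k0} \<times> L) (before ?m ?X s)"
    by (rule ef_trans[OF ef_singleton_Times[of _ "\<lambda>p x. c (snd p) = c x"] eL])
      (use lin_on_irrefl[OF lin\<kappa> k0] in auto)

  let ?l = "lex_less ?k ?m"
  \<comment> \<open>This is L + T \<cdot> \<kappa>: in the row \<open>k0\<close>, elements of
    \<open>L\<close> come first because they lie below \<open>s\<close>.\<close>
  define V where "V = {k0} \<times> L \<union> Field \<kappa> \<times> T"
  have VZ: "V \<subseteq> Field \<kappa> \<times> Z" using k0 LZ TZ unfolding V_def by auto
  have linV: "lin_on V ?l"
    by (rule lin_on_subset[OF lin_on_lex_less[OF lin\<kappa> lin\<mu>]]) (use VZ Z(3) in auto)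
  have eV: "ef ?l ?m (\<lambda>p x. c (snd p) = c x) q V ?X"
  proof -
    have X: "before ?m ?X s \<union> from_on ?m ?X s = ?X"
      using lin_on_total[OF lin\<mu> s] unfolding before_def from_on_def by blast
    have LT: "?m x y" if "x \<in> before ?m ?X s" "y \<in> from_on ?m ?X s" for x y
      using that lin_on_trans[OF lin\<mu>, of x s y] s unfolding before_def from_on_def by blast
    have "L \<subseteq> before ?m ?X s" "T \<subseteq> from_on ?m ?X s"
      using Z(3) unfolding L_def T_def before_def from_on_def by auto
    then have "?m x y" if "x \<in> L" "y \<in> T" for x y using LT that by blast
    then have p1: "precedes ?l ({k0} \<times> L) (Field \<kappa> \<times> T)"
      unfolding precedes_def lex_less_def using k0_least by simp blast
    have p2: "precedes ?m (before ?m ?X s) (from_on ?m ?X s)"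
      using LT unfolding precedes_def by blast
    have "lin_on (before ?m ?X s \<union> from_on ?m ?X s) ?m" unfolding X by (rule lin\<mu>)
    from ef_concat[OF e1 e2 linV[unfolded V_def] p1 this p2]
    have "ef ?l ?m (\<lambda>p x. c (snd p) = c x) q V (before ?m ?X s \<union> from_on ?m ?X s)"
      unfolding V_def .
    then show ?thesis unfolding X .
  qed

  define W where "W = rel_on V ?l"
  have W: "Well_order W" and FW: "Field W = V"
    unfolding W_def
    by (rule Well_order_rel_on[OF linV wfp_lex_less[OF wfp_strict[OF wo\<kappa>] wfp_strict[OF wo\<mu>]]])
      (rule Field_rel_on)
  have "W =o \<kappa>"
  proof (rule ordIso_Card_orderI[OF W assms(2)])
    have "|Field \<kappa>| \<le>o |V|"
    proof (rule card_of_ordLeqI[of "\<lambda>k. (k, s)"])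
      show "inj_on (\<lambda>k. (k, s)) (Field \<kappa>)" by (rule inj_onI) simp
    qed (use sT in \<open>auto simp: V_def\<close>)
    then show "\<kappa> \<le>o |Field W|"
      unfolding FW using card_of_Field_ordIso[OF assms(2)] ordIso_symmetric ordIso_ordLeq_trans by blast
  next
    fix p assume "p \<in> Field W"
    then have p: "fst p \<in> Field \<kappa>" using FW VZ by auto
    \<comment> \<open>Predecessors have index at most \<open>fst p\<close> and second coordinate in
      the countable set \<open>Z\<close>, so there are fewer than \<open>\<kappa>\<close> of
      them.\<close>
    have "underS W p \<subseteq> ({fst p} \<union> underS \<kappa> (fst p)) \<times> Z"
      using VZ unfolding W_def rel_on_def underS_def lex_less_def strict_def by auto
    then have "|underS W p| \<le>o |({fst p} \<union> underS \<kappa> (fst p)) \<times> Z|" by (rule card_of_mono1)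
    moreover have "|{fst p}| <o \<kappa>" using finite_iff_ordLess_natLeq assms(4) ordLess_transitive by blast
    then have "|{fst p} \<union> underS \<kappa> (fst p)| <o \<kappa>"
      using card_of_Un_ordLess_infinite_Field[OF infinite_Field_natLeq_less[OF assms(4)] assms(2)] card_of_underS[OF assms(2) p]
      by blast
    moreover have "|Z| <o \<kappa>"
      using Z(1) assms(4) countable_card_le_natLeq ordLeq_ordLess_trans by blast
    ultimately show "|underS W p| <o \<kappa>"
      using card_of_Times_less[OF assms(4)] ordLeq_ordLess_trans by blast
  qed
  then obtain f where "iso W \<kappa> f" unfolding ordIso_def by blast
  then have f: "bij_betw f V (Field \<kappa>)"
    and f_ord: "\<And>p p'. p \<in> V \<Longrightarrow> p' \<in> V \<Longrightarrow> (p, p') \<in> W \<longleftrightarrow> (f p, f p') \<in> \<kappa>"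
    using iso_iff2[of W \<kappa> f] FW by auto
  have inj: "inj_on f V" and im: "f ` V = Field \<kappa>" using f unfolding bij_betw_def by auto
  have eW: "ef ?l ?k (\<lambda>p y. p \<in> V \<and> y = f p) q V (Field \<kappa>)"
  proof (rule ef_iso[OF im])
    fix p p' assume p: "p \<in> V" "p' \<in> V"
    have "?k (f p) (f p') \<longleftrightarrow> strict W p p'"
      using f_ord[OF p] inj_on_eq_iff[OF inj p] unfolding strict_def by simp
    then show "?k (f p) (f p') \<longleftrightarrow> ?l p p'" unfolding W_def strict_rel_on[OF linV] using p by simp
  qed simp
  \<comment> \<open>The two pairings are composed through \<open>V\<close>: a point of
    \<open>\<mu>\<close> is matched with the image under \<open>f\<close> of a pair of the same
    colour.\<close>
  have e: "ef ?m ?k (\<lambda>x y. \<exists>p\<in>V. c (snd p) = c x \<and> y = f p) q ?X (Field \<kappa>)"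
    by (rule ef_trans[OF ef_sym[OF eV] eW]) blast

  \<comment> \<open>Colours are transported from second coordinates along \<open>f\<close>;
    injectivity of \<open>f\<close> on \<open>V\<close> keeps the classes disjoint.\<close>
  define D where "D i = f ` {p \<in> V. c (snd p) = i}" for i
  have "(\<Union>i<d. D i) = Field \<kappa>"
  proof -
    have "c (snd p) < d" if "p \<in> V" for p using that VZ Z(3) c by force
    then have "(\<Union>i<d. D i) = f ` V" unfolding D_def by auto
    then show ?thesis using im by simp
  qed
  moreover have "disjoint_family_on D {..<d}"
    using inj unfolding disjoint_family_on_def D_def inj_on_def by blast
  ultimately have "colored_ordinal d \<kappa> D" unfolding colored_ordinal_def using wo\<kappa> by blast
  moreover have "fo_equiv d q \<mu> C \<kappa> D"
  proof (rule ef_imp_fo_equiv[OF e lin\<mu> lin\<kappa>])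
    fix x y i assume x: "x \<in> ?X" and i: "i < d" and "\<exists>p\<in>V. c (snd p) = c x \<and> y = f p"
    then obtain p where p: "p \<in> V" "c (snd p) = c x" "y = f p" by blast
    have "y \<in> D i \<longleftrightarrow> c (snd p) = i"
      using inj_on_eq_iff[OF inj p(1)] p(1) unfolding D_def p(3) by auto
    then show "x \<in> C i \<longleftrightarrow> y \<in> D i" using cC[OF x i] p(2) by simp
  qed
  ultimately show ?thesis by blast
qed

end
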